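(* Let $(u,P,\zeta,L,R)$ be a (sufficiently regular) solution of the free-boundary Stokes droplet system of the context. Then $$\frac{d}{dt}\left(\int_{L}^{R}\frac g2|\zeta|^2\,dz_1+\int_L^R\sigma\sqrt{1+|\partial_{z_1}\zeta|^2}\,dz_1-[\gamma](R-L)\right)$$ $$+\left(\int_{\Omega(t)}\frac\mu2|\mathbb D_zu|^2+\int_{\Sigma_b(t)}\beta|u\cdot\tau|^2+\big(\mathscr W(\partial_tL)\partial_tL+\mathscr W(\partial_tR)\partial_tR\big)\right)=0.$$
   Context: Constants: $g,\sigma,\mu,\beta>0$ and $[\gamma]\in\mathbb R$ with $0<[\gamma]/\sigma<1$. $\mathscr V:\mathbb R\to\mathbb R$ is a $C^2$ increasing diffeomorphism with $\mathscr V(0)=0$, and $\mathscr W=\mathscr V^{-1}\in C^2(\mathbb R)$. At time $t$ the fluid occupies $\Omega(t)=\{z\in\mathbb R^2:\ L(t)<z_1<R(t),\ 0<z_2<\zeta(t,z_1)\}$, where $\zeta(t,\cdot):[L(t),R(t)]\to[0,\infty)$ is positive in the interior and $\zeta(t,L(t))=\zeta(t,R(t))=0$. Let $\Sigma(t)=\{L(t)<z_1<R(t),\ z_2=\zeta(t,z_1)\}$ and $\Sigma_b(t)=\{L(t)<z_1<R(t),\ z_2=0\}$; $\nu$ is the outward unit normal and $\tau$ the associated unit tangent. $\mathbb D_zu=\nabla_zu+(\nabla_zu)^T$, $S(P,u)=PI-\mu\mathbb D_zu$, $\mathcal H(\zeta)=\partial_{z_1}\big(\partial_{z_1}\zeta/\sqrt{1+|\partial_{z_1}\zeta|^2}\big)$.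 The system is: $\nabla_z\cdot S(P,u)=-\mu\Delta_zu+\nabla_zP=0$ and $\nabla_z\cdot u=0$ in $\Omega(t)$; $S(P,u)\nu=g\zeta\nu-\sigma\mathcal H(\zeta)\nu$ on $\Sigma(t)$; $(S(P,u)\nu-\beta u)\cdot\tau=0$ and $u\cdot\nu=0$ on $\Sigma_b(t)$; $\partial_t\zeta+u_1\partial_{z_1}\zeta-u_2=0$ on $\Sigma(t)$; $$\partial_tL=\mathscr V\Big(\tfrac{\sigma}{\sqrt{1+|\partial_{z_1}\zeta|^2}}\Big|_{z_1=L}-[\gamma]\Big),\qquad \partial_tR=\mathscr V\Big([\gamma]-\tfrac{\sigma}{\sqrt{1+|\partial_{z_1}\zeta|^2}}\Big|_{z_1=R}\Big).$$ *)

theory Defs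
  imports "HOL-Analysis.Analysis"
begin

section \<open>Regularity\<close>

text \<open>
  \<open>C1_upto U K f\<close> is meant for an open set \<open>U\<close> and \<open>U \<subseteq> K \<subseteq> closure U\<close>: \<open>f\<close> is differentiable
  in \<open>U\<close>, and both \<open>f\<close> and all its directional derivatives extend continuously from \<open>U\<close> to \<open>K\<close>
  (the extension of \<open>f\<close> being \<open>f\<close> itself).  So \<open>K = U\<close> gives the class \<open>C\<^sup>1(U)\<close> and \<open>K = closure U\<close>
  gives the usual \<open>C\<^sup>1(closure U)\<close>.
\<close>

definition C1_upto ::
  "'a::euclidean_space set \<Rightarrow> 'a set \<Rightarrow> ('a \<Rightarrow> 'b::real_normed_vector) \<Rightarrow> bool" where
  "C1_upto U K f \<longleftrightarrow>
     continuous_on K f \<and>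
     (\<forall>z\<in>U. f differentiable (at z)) \<and>
     (\<forall>v. \<exists>G. continuous_on K G \<and> (\<forall>z\<in>U. G z = frechet_derivative f (at z) v))"

definition C2_real :: "(real \<Rightarrow> real) \<Rightarrow> bool" where
  "C2_real f \<longleftrightarrow> f C1_differentiable_on UNIV \<and> deriv f C1_differentiable_on UNIV"

definition increasing_C2_diffeo :: "(real \<Rightarrow> real) \<Rightarrow> bool" where
  "increasing_C2_diffeo V \<longleftrightarrow> strict_mono V \<and> bij V \<and> C2_real V \<and> C2_real (inv V)"

section \<open>Differential operators in the plane\<close>

definition divergence :: "(real^2 \<Rightarrow> real^2) \<Rightarrow> real^2 \<Rightarrow> real" where
  "divergence v z = trace (jacobian v (at z))"

definition gradient :: "(real^2 \<Rightarrow> real) \<Rightarrow> real^2 \<Rightarrow> real^2" where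
  "gradient p z = (\<chi> j. frechet_derivative p (at z) (axis j 1))"

definition laplacian :: "(real^2 \<Rightarrow> real^2) \<Rightarrow> real^2 \<Rightarrow> real^2" where
  "laplacian v z = (\<chi> i. divergence (gradient (\<lambda>w. v w $ i)) z)"

text \<open>Row-wise divergence of a matrix field: \<open>(\<nabla>\<cdot>S)\<^sub>i = \<Sum>\<^sub>j \<partial>\<^sub>j S\<^sub>i\<^sub>j\<close>.\<close>

definition matrix_divergence :: "(real^2 \<Rightarrow> real^2^2) \<Rightarrow> real^2 \<Rightarrow> real^2" where
  "matrix_divergence S z = (\<chi> i. divergence (\<lambda>w. S w $ i) z)"

definition sym_gradient :: "(real^2 \<Rightarrow> real^2) \<Rightarrow> real^2 \<Rightarrow> real^2^2" where
  "sym_gradient v z = jacobian v (at z) + transpose (jacobian v (at z))"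

definition stress :: "real \<Rightarrow> (real^2 \<Rightarrow> real) \<Rightarrow> (real^2 \<Rightarrow> real^2) \<Rightarrow> real^2 \<Rightarrow> real^2^2" where
  "stress \<mu> p v z = p z *\<^sub>R mat 1 - \<mu> *\<^sub>R sym_gradient v z"

section \<open>Geometry at a fixed time\<close>

text \<open>
  Here \<open>l\<close>, \<open>r\<close> are the contact points and \<open>h\<close> is the height function; only the values of \<open>h\<close> on
  \<open>{l..r}\<close> are relevant.  The derivative \<open>slope l r h\<close> is one-sided at \<open>l\<close> and \<open>r\<close>.
\<close>

definition fluid_domain :: "real \<Rightarrow> real \<Rightarrow> (real \<Rightarrow> real) \<Rightarrow> (real^2) set" where
  "fluid_domain l r h = {z. l < z $ 1 \<and> z $ 1 < r \<and> 0 < z $ 2 \<and> z $ 2 < h (z $ 1)}"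

definition slope :: "real \<Rightarrow> real \<Rightarrow> (real \<Rightarrow> real) \<Rightarrow> real \<Rightarrow> real" where
  "slope l r h x = vector_derivative h (at x within {l..r})"

definition curvature :: "real \<Rightarrow> real \<Rightarrow> (real \<Rightarrow> real) \<Rightarrow> real \<Rightarrow> real" where
  "curvature l r h x = deriv (\<lambda>y. slope l r h y / sqrt (1 + (slope l r h y)\<^sup>2)) x"

definition surface_point :: "(real \<Rightarrow> real) \<Rightarrow> real \<Rightarrow> real^2" where
  "surface_point h x = vector [x, h x]"

definition surface_normal :: "real \<Rightarrow> real \<Rightarrow> (real \<Rightarrow> real) \<Rightarrow> real \<Rightarrow> real^2" where
  "surface_normal l r h x =
     (1 / sqrt (1 + (slope l r h x)\<^sup>2)) *\<^sub>R vector [- slope l r h x, 1]"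

definition bottom_point :: "real \<Rightarrow> real^2" where
  "bottom_point x = vector [x, 0]"

definition bottom_normal :: "real^2" where
  "bottom_normal = vector [0, - 1]"

definition bottom_tangent :: "real^2" where
  "bottom_tangent = vector [1, 0]"

text \<open>
  The stress tensor at a boundary point is the limit of its values from inside the fluid.
\<close>

definition boundary_stress ::
  "real \<Rightarrow> (real^2) set \<Rightarrow> (real^2 \<Rightarrow> real) \<Rightarrow> (real^2 \<Rightarrow> real^2) \<Rightarrow> real^2 \<Rightarrow> real^2^2" where
  "boundary_stress \<mu> \<Omega> p v z = Lim (at z within \<Omega>) (stress \<mu> p v)"

section \<open>The droplet system\<close>

text \<open>
  The unknowns are total functions: \<open>\<zeta> t x\<close> matters for \<open>L t \<le> x \<le> R t\<close>, and \<open>u t z\<close>, \<open>P t z\<close> matter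
  for \<open>z\<close> in the closure of the fluid domain at time \<open>t\<close>; \<open>I\<close> is the set of times.
\<close>

definition droplet_geometry ::
  "real set \<Rightarrow> (real \<Rightarrow> real) \<Rightarrow> (real \<Rightarrow> real) \<Rightarrow> (real \<Rightarrow> real \<Rightarrow> real) \<Rightarrow> bool" where
  "droplet_geometry I L R \<zeta> \<longleftrightarrow>
     (\<forall>t\<in>I. L t < R t \<and> \<zeta> t (L t) = 0 \<and> \<zeta> t (R t) = 0 \<and> (\<forall>x\<in>{L t<..<R t}. 0 < \<zeta> t x))"

text \<open>
  Classical regularity: \<open>L\<close>, \<open>R\<close> are differentiable, \<open>\<zeta>\<close> and \<open>\<partial>\<^sub>1 \<zeta>\<close> are \<open>C\<^sup>1\<close> in time and space up to
  the contact points, and at each time \<open>u \<in> C\<^sup>2(\<Omega>) \<inter> C\<^sup>1(closure \<Omega>)\<close> and \<open>P \<in> C\<^sup>1(\<Omega>) \<inter> C\<^sup>0(closure \<Omega>)\<close>.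
  No regularity of \<open>u\<close> and \<open>P\<close> in time is required.
\<close>

definition droplet_regular ::
  "real set \<Rightarrow> (real \<Rightarrow> real) \<Rightarrow> (real \<Rightarrow> real) \<Rightarrow> (real \<Rightarrow> real \<Rightarrow> real) \<Rightarrow>
   (real \<Rightarrow> real^2 \<Rightarrow> real^2) \<Rightarrow> (real \<Rightarrow> real^2 \<Rightarrow> real) \<Rightarrow> bool" where
  "droplet_regular I L R \<zeta> u P \<longleftrightarrow>
     (\<forall>t\<in>I. L differentiable (at t) \<and> R differentiable (at t)) \<and>
     (let U = {(t, x). t \<in> I \<and> L t < x \<and> x < R t};
          K = {(t, x). t \<in> I \<and> L t \<le> x \<and> x \<le> R t}
      in C1_upto U K (\<lambda>(t, x). \<zeta> t x) \<and>
         C1_upto U K (\<lambda>(t, x). slope (L t) (R t) (\<zeta> t) x)) \<and>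
     (\<forall>t\<in>I. let \<Omega> = fluid_domain (L t) (R t) (\<zeta> t)
      in C1_upto \<Omega> (closure \<Omega>) (u t) \<and>
         C1_upto \<Omega> \<Omega> (\<lambda>z. jacobian (u t) (at z)) \<and>
         C1_upto \<Omega> \<Omega> (P t) \<and> continuous_on (closure \<Omega>) (P t))"

definition stokes_in_bulk ::
  "real \<Rightarrow> (real^2) set \<Rightarrow> (real^2 \<Rightarrow> real^2) \<Rightarrow> (real^2 \<Rightarrow> real) \<Rightarrow> bool" where
  "stokes_in_bulk \<mu> \<Omega> v p \<longleftrightarrow>
     (\<forall>z\<in>\<Omega>.
        matrix_divergence (stress \<mu> p v) z = - \<mu> *\<^sub>R laplacian v z + gradient p z \<and>
        - \<mu> *\<^sub>R laplacian v z + gradient p z = 0 \<and>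
        divergence v z = 0)"

definition free_surface_condition ::
  "real \<Rightarrow> real \<Rightarrow> real \<Rightarrow> real \<Rightarrow> real \<Rightarrow> (real \<Rightarrow> real) \<Rightarrow>
   (real^2 \<Rightarrow> real^2) \<Rightarrow> (real^2 \<Rightarrow> real) \<Rightarrow> bool" where
  "free_surface_condition g \<sigma> \<mu> l r h v p \<longleftrightarrow>
     (\<forall>x\<in>{l<..<r}.
        boundary_stress \<mu> (fluid_domain l r h) p v (surface_point h x) *v surface_normal l r h x =
          (g * h x) *\<^sub>R surface_normal l r h x
          - (\<sigma> * curvature l r h x) *\<^sub>R surface_normal l r h x)"

definition navier_slip_condition ::
  "real \<Rightarrow> real \<Rightarrow> real \<Rightarrow> real \<Rightarrow> (real \<Rightarrow> real) \<Rightarrow>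
   (real^2 \<Rightarrow> real^2) \<Rightarrow> (real^2 \<Rightarrow> real) \<Rightarrow> bool" where
  "navier_slip_condition \<mu> \<beta> l r h v p \<longleftrightarrow>
     (\<forall>x\<in>{l<..<r}.
        (boundary_stress \<mu> (fluid_domain l r h) p v (bottom_point x) *v bottom_normal
           - \<beta> *\<^sub>R v (bottom_point x)) \<bullet> bottom_tangent = 0 \<and>
        v (bottom_point x) \<bullet> bottom_normal = 0)"

definition kinematic_condition ::
  "real set \<Rightarrow> (real \<Rightarrow> real) \<Rightarrow> (real \<Rightarrow> real) \<Rightarrow> (real \<Rightarrow> real \<Rightarrow> real) \<Rightarrow>
   (real \<Rightarrow> real^2 \<Rightarrow> real^2) \<Rightarrow> bool" where
  "kinematic_condition I L R \<zeta> u \<longleftrightarrow>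
     (\<forall>t\<in>I. \<forall>x\<in>{L t<..<R t}.
        deriv (\<lambda>s. \<zeta> s x) t
          + u t (surface_point (\<zeta> t) x) $ 1 * slope (L t) (R t) (\<zeta> t) x
          - u t (surface_point (\<zeta> t) x) $ 2 = 0)"

definition contact_point_law ::
  "real \<Rightarrow> real \<Rightarrow> (real \<Rightarrow> real) \<Rightarrow>
   real set \<Rightarrow> (real \<Rightarrow> real) \<Rightarrow> (real \<Rightarrow> real) \<Rightarrow> (real \<Rightarrow> real \<Rightarrow> real) \<Rightarrow> bool" where
  "contact_point_law \<sigma> \<gamma> V I L R \<zeta> \<longleftrightarrow>
     (\<forall>t\<in>I.
        deriv L t = V (\<sigma> / sqrt (1 + (slope (L t) (R t) (\<zeta> t) (L t))\<^sup>2) - \<gamma>) \<and>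
        deriv R t = V (\<gamma> - \<sigma> / sqrt (1 + (slope (L t) (R t) (\<zeta> t) (R t))\<^sup>2)))"

definition droplet_solution ::
  "real \<Rightarrow> real \<Rightarrow> real \<Rightarrow> real \<Rightarrow> real \<Rightarrow> (real \<Rightarrow> real) \<Rightarrow> real set \<Rightarrow>
   (real \<Rightarrow> real^2 \<Rightarrow> real^2) \<Rightarrow> (real \<Rightarrow> real^2 \<Rightarrow> real) \<Rightarrow> (real \<Rightarrow> real \<Rightarrow> real) \<Rightarrow>
   (real \<Rightarrow> real) \<Rightarrow> (real \<Rightarrow> real) \<Rightarrow> bool" where
  "droplet_solution g \<sigma> \<mu> \<beta> \<gamma> V I u P \<zeta> L R \<longleftrightarrow>
     droplet_geometry I L R \<zeta> \<and>
     (\<forall>t\<in>I.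
        stokes_in_bulk \<mu> (fluid_domain (L t) (R t) (\<zeta> t)) (u t) (P t) \<and>
        free_surface_condition g \<sigma> \<mu> (L t) (R t) (\<zeta> t) (u t) (P t) \<and>
        navier_slip_condition \<mu> \<beta> (L t) (R t) (\<zeta> t) (u t) (P t)) \<and>
     kinematic_condition I L R \<zeta> u \<and>
     contact_point_law \<sigma> \<gamma> V I L R \<zeta>"

end

theory Submission
  imports Defs
begin

text \<open>
  The energy can change only through the motion of the free surface and of the contact points.  The
  first variation of gravitational and surface energy gives
  \<open>dE/dt = \<integral> (g \<zeta> - \<sigma> H) \<partial>\<^sub>t\<zeta> dx + \<sigma> (R' cos \<theta>\<^sub>R - L' cos \<theta>\<^sub>L) - \<gamma> (R' - L')\<close>,
  where \<open>H\<close> is the curvature and \<open>cos \<theta> = 1/\<surd>(1 + |\<partial>\<^sub>x\<zeta>|\<^sup>2)\<close> at the two contact points (lemma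
  \<open>droplet_energy_derivative\<close>).  By the contact point law the endpoint terms are
  \<open>- W(L') L' - W(R') R'\<close>.  By the kinematic condition \<open>\<partial>\<^sub>t\<zeta>\<close> is the normal velocity up to the arc length
  factor, and by the dynamic condition \<open>g \<zeta> - \<sigma> H\<close> is the normal stress, so the integral is the flux of
  \<open>S u\<close> through the free surface.  Testing the Stokes equation with \<open>u\<close> shows that this flux is minus the
  viscous dissipation in the bulk and the friction at the bottom (lemma \<open>stokes_power_balance\<close>).

  Two points need care under classical regularity.  The second derivatives of \<open>u\<close> are not controlled
  near the boundary and the droplet may end in cusps.  The divergence theorem is therefore proved for
  fields that are continuous up to the boundary and \<open>C\<^sup>1\<close> inside, by flattening the domain to
  a rectangle with a Piola transform (\<open>rectangle_divergence_theorem\<close>, \<open>subgraph_divergence_theorem\<close>).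
  Secondly, the interval \<open>[L, R]\<close> moves, and at its ends \<open>\<zeta>\<close> is controlled only from inside.  Over a fixed
  parameter interval the time derivatives extend to the ends
  (\<open>moving_interval_time_derivative\<close>), and \<open>\<zeta> = 0\<close> at the contact points becomes a boundary
  condition that can be differentiated in time.
\<close>

section \<open>Integration over the fluid domain\<close>

lemma vector_2_eq_axis: "vector [x, y] = x *\<^sub>R axis 1 1 + y *\<^sub>R (axis 2 1 :: real^2)"
  by (simp add: vec_eq_iff forall_2 axis_def)

lemma continuous_on_vector_2 [continuous_intros]:
  fixes f g :: "'a::topological_space \<Rightarrow> real"
  assumes "continuous_on S f" "continuous_on S g"
  shows "continuous_on S (\<lambda>x. vector [f x, g x] :: real^2)"
  unfolding vector_2_eq_axis by (intro continuous_intros assms)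

lemma measurable_vector_2 [measurable]:
  "(\<lambda>(x, y). vector [x, y] :: real^2) \<in> borel_measurable (lborel \<Otimes>\<^sub>M lborel)"
proof -
  have "(\<lambda>p. vector [fst p, snd p] :: real^2) \<in> borel_measurable borel"
    by (intro borel_measurable_continuous_onI continuous_intros continuous_on_fst continuous_on_snd)
  then show ?thesis
    by (simp add: lborel_prod split_beta)
qed

text \<open>
  Carries Fubini's theorem over from pairs of reals to the vector type of the fluid domain.
\<close>

lemma lborel_real_2: "lborel = distr (lborel \<Otimes>\<^sub>M lborel) borel (\<lambda>(x, y). vector [x, y] :: real^2)"
proof (rule lborel_eqI)
  let ?T = "\<lambda>(x, y). vector [x, y] :: real^2"
  fix l u :: "real^2"
  assume le: "\<And>b. b \<in> Basis \<Longrightarrow> l \<bullet> b \<le> u \<bullet> b"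
  have le12: "l $ i \<le> u $ i" for i
    using le[of "axis i 1"] by (simp add: inner_axis)
  have eq: "?T -` box l u \<inter> space (lborel \<Otimes>\<^sub>M lborel) = box (l $ 1) (u $ 1) \<times> box (l $ 2) (u $ 2)"
    by (auto simp: space_pair_measure mem_box_cart forall_2)
  have B: "(Basis :: (real^2) set) = {axis 1 1, axis 2 1}"
    by (auto simp: Basis_vec_def UNIV_2)
  have "emeasure (distr (lborel \<Otimes>\<^sub>M lborel) borel ?T) (box l u)
      = emeasure (lborel \<Otimes>\<^sub>M lborel) (box (l $ 1) (u $ 1) \<times> box (l $ 2) (u $ 2))"
    by (subst emeasure_distr) (auto simp: eq)
  also have "\<dots> = ennreal (u $ 1 - l $ 1) * ennreal (u $ 2 - l $ 2)"
    using le12 by (subst lborel.emeasure_pair_measure_Times) auto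
  also have "\<dots> = ennreal ((u $ 1 - l $ 1) * (u $ 2 - l $ 2))"
    using le12 by (simp add: ennreal_mult)
  also have "(u $ 1 - l $ 1) * (u $ 2 - l $ 2) = (\<Prod>b\<in>Basis. (u - l) \<bullet> b)"
    unfolding B by (subst prod.insert) (auto simp: axis_eq_axis inner_axis)
  finally show "emeasure (distr (lborel \<Otimes>\<^sub>M lborel) borel ?T) (box l u)
      = ennreal (\<Prod>b\<in>Basis. (u - l) \<bullet> b)" .
qed simp

lemma open_fluid_domain:
  assumes h: "continuous_on {l..r} h"
  shows "open (fluid_domain l r h)"
proof -
  let ?S = "{z :: real^2. l < z $ 1 \<and> z $ 1 < r}"
  have S: "open ?S"
    by (auto intro!: open_Collect_conj open_Collect_less continuous_intros)
  have "continuous_on ?S (\<lambda>z. h (z $ 1))"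
    by (rule continuous_on_compose2[OF h]) (auto intro!: continuous_intros)
  then have "continuous_on ?S (\<lambda>z. h (z $ 1) - z $ 2)" "continuous_on ?S (\<lambda>z :: real^2. z $ 2)"
    by (auto intro!: continuous_intros)
  then have "open (?S \<inter> (\<lambda>z. h (z $ 1) - z $ 2) -` {0<..})" "open (?S \<inter> (\<lambda>z. z $ 2) -` {0<..})"
    using S by (auto intro!: continuous_open_preimage)
  then have "open ((?S \<inter> (\<lambda>z. h (z $ 1) - z $ 2) -` {0<..}) \<inter> (?S \<inter> (\<lambda>z. z $ 2) -` {0<..}))"
    by (rule open_Int)
  also have "\<dots> = fluid_domain l r h"
    by (auto simp: fluid_domain_def)
  finally show ?thesis .
qed

lemma bounded_fluid_domain:
  assumes h: "continuous_on {l..r} h"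
  shows "bounded (fluid_domain l r h)"
proof -
  have "bounded (h ` {l..r})"
    using compact_continuous_image[OF h] compact_imp_bounded by blast
  then obtain B where B: "\<And>x. x \<in> {l..r} \<Longrightarrow> norm (h x) \<le> B"
    unfolding bounded_iff by (metis imageI)
  have "fluid_domain l r h \<subseteq> cbox (vector [l, 0]) (vector [r, B])"
  proof
    fix z assume "z \<in> fluid_domain l r h"
    then show "z \<in> cbox (vector [l, 0]) (vector [r, B])"
      using B[of "z $ 1"] by (auto simp: fluid_domain_def mem_box_cart forall_2)
  qed
  then show ?thesis
    using bounded_cbox bounded_subset by blast
qed

text \<open>
  The map \<open>(x, \<eta>) \<mapsto> (x, \<eta> h(x))\<close> flattens the fluid domain to a rectangle.  The vertical sides
  of the rectangle collapse to the contact points, so membership there is not immediate: it is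
  inherited from the open rectangle by continuity.
\<close>

lemma strip_subset_closure_fluid_domain:
  assumes "l < r" and h: "continuous_on {l..r} h" and pos: "\<And>x. x \<in> {l<..<r} \<Longrightarrow> 0 < h x"
    and "x \<in> {l..r}" "\<eta> \<in> {0..1}"
  shows "vector [x, \<eta> * h x] \<in> closure (fluid_domain l r h)"
proof -
  let ?m = "\<lambda>(x, \<eta>). vector [x, \<eta> * h x] :: real^2"
  have cl: "closure ({l<..<r} \<times> {0<..<1::real}) = {l..r} \<times> {0..1}"
    using \<open>l < r\<close> by (simp add: closure_Times)
  have "?m ` closure ({l<..<r} \<times> {0<..<1}) \<subseteq> closure (fluid_domain l r h)"
  proof (rule image_closure_subset)
    show "continuous_on (closure ({l<..<r} \<times> {0<..<1})) ?m"
      unfolding cl split_beta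
      by (intro continuous_intros continuous_on_compose2[OF h, of _ fst]) auto
    have "?m ` ({l<..<r} \<times> {0<..<1}) \<subseteq> fluid_domain l r h"
      using pos by (auto simp: fluid_domain_def)
    then show "?m ` ({l<..<r} \<times> {0<..<1}) \<subseteq> closure (fluid_domain l r h)"
      using closure_subset by blast
  qed simp
  then show ?thesis
    unfolding cl using assms(4,5) by (auto simp: image_subset_iff)
qed

lemma continuous_on_strip:
  fixes D :: "real^2 \<Rightarrow> 'b::topological_space"
  assumes "l < r" and h: "continuous_on {l..r} h" and pos: "\<And>x. x \<in> {l<..<r} \<Longrightarrow> 0 < h x"
    and D: "continuous_on (closure (fluid_domain l r h)) D"
  shows "continuous_on ({l..r} \<times> {0..1}) (\<lambda>(x, \<eta>). D (vector [x, \<eta> * h x]))"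
  unfolding split_beta
  by (rule continuous_on_compose2[OF D])
     (auto intro!: continuous_intros continuous_on_compose2[OF h, of _ fst]
        strip_subset_closure_fluid_domain[OF \<open>l < r\<close> h pos])

lemma integral_fluid_domain:
  fixes D :: "real^2 \<Rightarrow> real"
  assumes "l < r" and h: "continuous_on {l..r} h" and pos: "\<And>x. x \<in> {l<..<r} \<Longrightarrow> 0 < h x"
    and D: "continuous_on (closure (fluid_domain l r h)) D"
  shows "integral (fluid_domain l r h) D
       = integral {l..r} (\<lambda>x. integral {0..1} (\<lambda>\<eta>. h x * D (vector [x, \<eta> * h x])))"
proof -
  let ?\<Omega> = "fluid_domain l r h"
  define f where "f = (\<lambda>z. indicator ?\<Omega> z *\<^sub>R D z)"
  define k where "k = (\<lambda>x. integral {0..1} (\<lambda>\<eta>. h x * D (vector [x, \<eta> * h x])))"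
  have [measurable]: "?\<Omega> \<in> sets borel"
    using open_fluid_domain[OF h] by auto
  have "compact (closure ?\<Omega>)"
    using bounded_fluid_domain[OF h] by (simp add: compact_closure)
  then have "set_integrable lborel (closure ?\<Omega>) D"
    unfolding set_integrable_def using D by (rule borel_integrable_compact)
  then have si: "set_integrable lborel ?\<Omega> D"
    by (rule set_integrable_subset) (auto intro: closure_subset[THEN subsetD])
  then have fi: "integrable lborel f"
    by (simp add: f_def set_integrable_def)
  have fm: "f \<in> borel_measurable borel"
    using borel_measurable_integrable[OF fi] by simp
  have fi2: "integrable (lborel \<Otimes>\<^sub>M lborel) (\<lambda>p. f (case p of (x, y) \<Rightarrow> vector [x, y]))"
    using fi unfolding lborel_real_2 integrable_distr_eq[OF measurable_vector_2 fm] .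
  \<comment> \<open>The substitution \<open>y = \<eta> h(x)\<close> needs \<open>h(x) > 0\<close>, so it is carried out slice by slice over the
    open interval only.\<close>
  have slice: "continuous_on {0..h x} (\<lambda>y. D (vector [x, y]))" if x: "x \<in> {l<..<r}" for x
  proof (rule continuous_on_compose2[OF D])
    show "(\<lambda>y. vector [x, y]) ` {0..h x} \<subseteq> closure ?\<Omega>"
    proof clarify
      fix y assume "y \<in> {0..h x}"
      then have "y = (y / h x) * h x" "y / h x \<in> {0..1}"
        using pos[OF x] by auto
      then show "vector [x, y] \<in> closure ?\<Omega>"
        using strip_subset_closure_fluid_domain[OF \<open>l < r\<close> h pos, of x "y / h x"] x by auto
    qed
  qed (intro continuous_intros)
  have inner: "(\<integral>y. f (vector [x, y]) \<partial>lborel) = indicator {l<..<r} x *\<^sub>R k x" for x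
  proof (cases "x \<in> {l<..<r}")
    case True
    have c: "continuous_on {0..h x} (\<lambda>y. D (vector [x, y]))"
      by (rule slice[OF True])
    have "(\<integral>y. f (vector [x, y]) \<partial>lborel) = (LINT y : {0<..<h x} | lborel. D (vector [x, y]))"
      unfolding set_lebesgue_integral_def f_def using True
      by (intro Bochner_Integration.integral_cong) (auto simp: fluid_domain_def indicator_def)
    also have "\<dots> = integral {0<..<h x} (\<lambda>y. D (vector [x, y]))"
      by (intro set_borel_integral_eq_integral(2)
            set_integrable_subset[OF borel_integrable_compact[OF _ c, folded set_integrable_def]]) auto
    also have "\<dots> = integral {0..h x} (\<lambda>y. D (vector [x, y]))"
      by (simp add: integral_open_interval_real)
    also have "\<dots> = k x"
    proof -
      have "((\<lambda>\<eta>. h x *\<^sub>R D (vector [x, \<eta> * h x])) has_integral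
              integral {0 * h x..1 * h x} (\<lambda>y. D (vector [x, y]))) {0..1}"
        using pos[OF True] c
        by (intro has_integral_substitution[where c = 0 and d = "h x"])
           (auto intro!: derivative_eq_intros simp: mult_left_le_one_le)
      then show ?thesis
        unfolding k_def by (simp add: has_integral_iff)
    qed
    finally show ?thesis using True by simp
  next
    case False
    then have "f (vector [x, y]) = 0" for y
      by (auto simp: f_def fluid_domain_def)
    with False show ?thesis by simp
  qed
  have st: "continuous_on ({l..r} \<times> cbox 0 1) (\<lambda>(x, \<eta>). D (vector [x, \<eta> * h x]))"
    unfolding cbox_interval by (rule continuous_on_strip[OF \<open>l < r\<close> h pos D])
  have "continuous_on {l..r} (\<lambda>x. integral (cbox 0 1) (\<lambda>\<eta>. h x * D (vector [x, \<eta> * h x])))"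
  proof (rule integral_continuous_on_param)
    have "continuous_on ({l..r} \<times> cbox 0 1) (\<lambda>p. h (fst p))"
      by (rule continuous_on_compose2[OF h]) (auto intro!: continuous_intros)
    then show "continuous_on ({l..r} \<times> cbox 0 1) (\<lambda>(x, \<eta>). h x * D (vector [x, \<eta> * h x]))"
      using st unfolding split_beta by (rule continuous_on_mult)
  qed
  then have kc: "continuous_on {l..r} k"
    by (simp add: k_def)
  have "integral ?\<Omega> D = (\<integral>z. f z \<partial>lborel)"
    using set_borel_integral_eq_integral(2)[OF si] by (simp add: f_def set_lebesgue_integral_def)
  also have "\<dots> = (\<integral>p. f (case p of (x, y) \<Rightarrow> vector [x, y]) \<partial>(lborel \<Otimes>\<^sub>M lborel))"
    unfolding lborel_real_2 integral_distr[OF measurable_vector_2 fm] ..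
  also have "\<dots> = (\<integral>x. \<integral>y. f (vector [x, y]) \<partial>lborel \<partial>lborel)"
    using lborel_pair.integral_fst'[OF fi2] by simp
  also have "\<dots> = (LINT x : {l<..<r} | lborel. k x)"
    unfolding inner set_lebesgue_integral_def ..
  also have "\<dots> = integral {l<..<r} k"
    by (intro set_borel_integral_eq_integral(2)
          set_integrable_subset[OF borel_integrable_compact[OF _ kc, folded set_integrable_def]]) auto
  also have "\<dots> = integral {l..r} k"
    by (simp add: integral_open_interval_real)
  finally show ?thesis by (simp add: k_def)
qed

section \<open>The divergence theorem on a rectangle\<close>

lemma continuous_on_slices:
  assumes "continuous_on (S \<times> T) (\<lambda>(x, y). f x y)"
  shows "x \<in> S \<Longrightarrow> continuous_on T (f x)" and "y \<in> T \<Longrightarrow> continuous_on S (\<lambda>x. f x y)"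
proof -
  show "continuous_on T (f x)" if "x \<in> S"
  proof -
    have "continuous_on T (\<lambda>y. (x, y))" by (intro continuous_intros)
    from continuous_on_compose2[OF assms this] that show ?thesis by auto
  qed
  show "continuous_on S (\<lambda>x. f x y)" if "y \<in> T"
  proof -
    have "continuous_on S (\<lambda>x. (x, y))" by (intro continuous_intros)
    from continuous_on_compose2[OF assms this] that show ?thesis by auto
  qed
qed

lemma continuous_on_swap_arguments:
  assumes "continuous_on (S \<times> T) (\<lambda>(x, y). f x y)"
  shows "continuous_on (T \<times> S) (\<lambda>(y, x). f x y)"
proof -
  have "continuous_on (T \<times> S) (\<lambda>p. (snd p, fst p))"
    by (intro continuous_intros)
  moreover have "(\<lambda>p. (snd p, fst p)) ` (T \<times> S) \<subseteq> S \<times> T"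
    by auto
  ultimately have "continuous_on (T \<times> S) (\<lambda>p. case (snd p, fst p) of (x, y) \<Rightarrow> f x y)"
    by (rule continuous_on_compose2[OF assms])
  then show ?thesis
    by (simp add: split_beta)
qed

lemma continuous_on_integral_interval:
  fixes f :: "'a::topological_space \<Rightarrow> real \<Rightarrow> real"
  assumes "continuous_on (S \<times> {a..b}) (\<lambda>(x, y). f x y)"
  shows "continuous_on S (\<lambda>x. integral {a..b} (f x))"
  using integral_continuous_on_param[of S a b f] assms by simp

text \<open>
  The two partial derivatives may blow up at the boundary; only their sum \<open>D\<close> is continuous up to
  it.  So neither can be integrated over the whole rectangle on its own, and the directions are
  treated one after the other.  For \<open>[c, d]\<close> inside \<open>(a, b)\<close>, the function
  \<open>x \<mapsto> \<integral>\<^sub>c\<^sup>d G1(x, y) dy\<close> is continuous on \<open>[l, r]\<close> and its derivative inside is expressed through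
  \<open>D\<close> and the values of \<open>G2\<close> alone.  Integrating it in \<open>x\<close> shows that \<open>g(y) = \<integral>\<^sub>l\<^sup>r G2(x, y) dx\<close> has a
  derivative \<open>E\<close> in \<open>(a, b)\<close> that is continuous on \<open>[a, b]\<close>, although \<open>\<integral>\<^sub>l\<^sup>r \<partial>\<^sub>y G2 dx\<close> need not even exist; the
  fundamental theorem of calculus for \<open>g\<close> is the assertion.
\<close>

lemma rectangle_divergence_theorem:
  fixes G1 G2 D A :: "real \<Rightarrow> real \<Rightarrow> real"
  assumes "l < r" "a < b"
    and G1: "continuous_on ({l..r} \<times> {a..b}) (\<lambda>(x, y). G1 x y)"
    and G2: "continuous_on ({l..r} \<times> {a..b}) (\<lambda>(x, y). G2 x y)"
    and D: "continuous_on ({l..r} \<times> {a..b}) (\<lambda>(x, y). D x y)"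
    and A: "continuous_on ({l<..<r} \<times> {a<..<b}) (\<lambda>(x, y). A x y)"
    and dG1: "\<And>x y. x \<in> {l<..<r} \<Longrightarrow> y \<in> {a<..<b} \<Longrightarrow>
               ((\<lambda>x. G1 x y) has_real_derivative A x y) (at x)"
    and dG2: "\<And>x y. x \<in> {l<..<r} \<Longrightarrow> y \<in> {a<..<b} \<Longrightarrow>
               (G2 x has_real_derivative D x y - A x y) (at y)"
  shows "integral {l..r} (\<lambda>x. integral {a..b} (D x))
       = integral {a..b} (\<lambda>y. G1 r y - G1 l y) + integral {l..r} (\<lambda>x. G2 x b - G2 x a)"
proof -
  define E where "E = (\<lambda>y. integral {l..r} (\<lambda>x. D x y) - (G1 r y - G1 l y))"
  define g where "g = (\<lambda>y. integral {l..r} (\<lambda>x. G2 x y))"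
  have lr: "l \<in> {l..r}" "r \<in> {l..r}" "l \<le> r" using \<open>l < r\<close> by auto
  have Ec: "continuous_on {a..b} E"
    unfolding E_def
    by (intro continuous_intros continuous_on_integral_interval[OF continuous_on_swap_arguments[OF D]]
          continuous_on_slices(1)[OF G1] lr)
  have gc: "continuous_on {a..b} g"
    unfolding g_def by (rule continuous_on_integral_interval[OF continuous_on_swap_arguments[OF G2]])
  have E_int: "integral {c..d} E = g d - g c" if cd: "a < c" "c \<le> d" "d < b" for c d
  proof -
    have sub: "{l..r} \<times> {c..d} \<subseteq> {l..r} \<times> {a..b}" using cd by auto
    note G1' = continuous_on_subset[OF G1 sub] and D' = continuous_on_subset[OF D sub]
    have "((\<lambda>x. integral {c..d} (D x) - (G2 x d - G2 x c)) has_integral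
            (integral {c..d} (G1 r) - integral {c..d} (G1 l))) {l..r}"
    proof (rule fundamental_theorem_of_calculus_interior[OF \<open>l \<le> r\<close>])
      show "continuous_on {l..r} (\<lambda>x. integral {c..d} (G1 x))"
        by (rule continuous_on_integral_interval[OF G1'])
      fix x assume x: "x \<in> {l<..<r}"
      have "((\<lambda>x. integral (cbox c d) (G1 x)) has_field_derivative integral (cbox c d) (A x))
              (at x within {l<..<r})"
      proof (rule leibniz_rule_field_derivative)
        show "((\<lambda>x. G1 x y) has_real_derivative A x y) (at x within {l<..<r})"
          if "x \<in> {l<..<r}" "y \<in> cbox c d" for x y
          using dG1[of x y] that cd by (auto intro: DERIV_subset)
        show "G1 x integrable_on cbox c d" if "x \<in> {l<..<r}" for x
          using continuous_on_slices(1)[OF G1', of x] that by (auto intro!: integrable_continuous_real)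
        show "continuous_on ({l<..<r} \<times> cbox c d) (\<lambda>(x, y). A x y)"
          by (rule continuous_on_subset[OF A]) (use cd in auto)
      qed (use x in auto)
      then have 1: "((\<lambda>x. integral {c..d} (G1 x)) has_real_derivative integral {c..d} (A x)) (at x)"
        using x by (simp add: at_within_open[of x "{l<..<r}"])
      have 2: "((\<lambda>y. D x y - A x y) has_integral (G2 x d - G2 x c)) {c..d}"
        using cd x by (intro fundamental_theorem_of_calculus)
           (auto simp: has_real_derivative_iff_has_vector_derivative[symmetric] intro!: DERIV_subset[OF dG2])
      have 3: "D x integrable_on {c..d}"
        using continuous_on_slices(1)[OF D', of x] x by (auto intro!: integrable_continuous_real)
      have "((\<lambda>y. D x y - (D x y - A x y)) has_integral
              integral {c..d} (D x) - (G2 x d - G2 x c)) {c..d}"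
        by (rule has_integral_diff[OF integrable_integral[OF 3] 2])
      then have "integral {c..d} (A x) = integral {c..d} (D x) - (G2 x d - G2 x c)"
        by (simp add: integral_unique)
      with 1 show "((\<lambda>x. integral {c..d} (G1 x)) has_vector_derivative
                     integral {c..d} (D x) - (G2 x d - G2 x c)) (at x)"
        by (simp add: has_real_derivative_iff_has_vector_derivative)
    qed
    then have "integral {c..d} (G1 r) - integral {c..d} (G1 l)
        = integral {l..r} (\<lambda>x. integral {c..d} (D x) - (G2 x d - G2 x c))"
      by (simp add: integral_unique)
    also have "\<dots> = integral {l..r} (\<lambda>x. integral {c..d} (D x)) - (g d - g c)"
    proof -
      have G2i: "(\<lambda>x. G2 x y) integrable_on {l..r}" if "y \<in> {a..b}" for y
        using continuous_on_slices(2)[OF G2 that] by (rule integrable_continuous_real)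
      have "g d - g c = integral {l..r} (\<lambda>x. G2 x d - G2 x c)"
        unfolding g_def using cd
        by (intro Henstock_Kurzweil_Integration.integral_diff[symmetric] G2i) auto
      moreover have "(\<lambda>x. G2 x d - G2 x c) integrable_on {l..r}"
        using cd by (intro integrable_diff G2i) auto
      moreover have "(\<lambda>x. integral {c..d} (D x)) integrable_on {l..r}"
        by (intro integrable_continuous_real continuous_on_integral_interval[OF D'])
      ultimately show ?thesis
        by (simp add: Henstock_Kurzweil_Integration.integral_diff)
    qed
    also have "integral {l..r} (\<lambda>x. integral {c..d} (D x)) = integral {c..d} (\<lambda>y. integral {l..r} (\<lambda>x. D x y))"
      using integral_swap_continuous[of l c r d D] D' by (simp add: cbox_Pair_eq)
    finally have *: "integral {c..d} (\<lambda>y. integral {l..r} (\<lambda>x. D x y))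
        - (integral {c..d} (G1 r) - integral {c..d} (G1 l)) = g d - g c"
      by simp
    have "continuous_on {c..d} (\<lambda>y. integral {l..r} (\<lambda>x. D x y))"
      by (rule continuous_on_subset[OF continuous_on_integral_interval[OF continuous_on_swap_arguments[OF D]]]) (use cd in auto)
    moreover have "continuous_on {c..d} (G1 r)" "continuous_on {c..d} (G1 l)"
      using continuous_on_slices(1)[OF G1'] lr by auto
    ultimately have "integral {c..d} E = integral {c..d} (\<lambda>y. integral {l..r} (\<lambda>x. D x y))
        - (integral {c..d} (G1 r) - integral {c..d} (G1 l))"
      unfolding E_def
      by (subst Henstock_Kurzweil_Integration.integral_diff, auto intro!: integrable_continuous_real continuous_intros)
         (subst Henstock_Kurzweil_Integration.integral_diff, auto intro!: integrable_continuous_real)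
    with * show ?thesis by simp
  qed
  have g': "(g has_vector_derivative E y) (at y)" if y: "y \<in> {a<..<b}" for y
  proof -
    obtain c d where cd: "a < c" "c < y" "y < d" "d < b"
      using dense[of a y] dense[of y b] y by auto
    have "((\<lambda>u. g c + integral {c..u} E) has_vector_derivative E y) (at y within {c..d})"
      using cd Ec
      by (auto intro!: derivative_eq_intros integral_has_vector_derivative elim!: continuous_on_subset)
    then have "(g has_vector_derivative E y) (at y within {c..d})"
      by (rule has_vector_derivative_transform[rotated 2]) (use cd E_int[of c] in auto)
    then show ?thesis
      using cd at_within_Icc_at[of c y d] by simp
  qed
  have "(E has_integral g b - g a) {a..b}"
    using fundamental_theorem_of_calculus_interior[OF _ gc g'] \<open>a < b\<close> by simp
  then have "integral {a..b} E = g b - g a" by (simp add: integral_unique)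
  moreover have "integral {a..b} E = integral {a..b} (\<lambda>y. integral {l..r} (\<lambda>x. D x y)) - integral {a..b} (\<lambda>y. G1 r y - G1 l y)"
    unfolding E_def
    by (intro Henstock_Kurzweil_Integration.integral_diff integrable_continuous_real continuous_intros
         continuous_on_integral_interval[OF continuous_on_swap_arguments[OF D]] continuous_on_slices(1)[OF G1] lr)
  moreover have "g b - g a = integral {l..r} (\<lambda>x. G2 x b - G2 x a)"
    unfolding g_def using \<open>a < b\<close>
    by (intro Henstock_Kurzweil_Integration.integral_diff[symmetric] integrable_continuous_real
         continuous_on_slices(2)[OF G2]) auto
  moreover have "integral {l..r} (\<lambda>x. integral {a..b} (D x)) = integral {a..b} (\<lambda>y. integral {l..r} (\<lambda>x. D x y))"
    using integral_swap_continuous[of l a r b D] D by (simp add: cbox_Pair_eq)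
  ultimately show ?thesis by simp
qed

section \<open>The divergence theorem under a graph\<close>

lemma has_real_derivative_along_curve:
  fixes F :: "'a::real_normed_vector \<Rightarrow> real"
  assumes p: "(p has_vector_derivative v) (at x)" and F: "(F has_derivative F') (at (p x))"
  shows "((\<lambda>x. F (p x)) has_real_derivative F' v) (at x)"
proof -
  have "((\<lambda>x. F (p x)) has_derivative (\<lambda>t. F' (t *\<^sub>R v))) (at x)"
    using has_derivative_compose[OF p[unfolded has_vector_derivative_def] F] .
  also have "(\<lambda>t. F' (t *\<^sub>R v)) = (*) (F' v)"
    using linear_scale[OF has_derivative_linear[OF F]] by (simp add: fun_eq_iff mult.commute)
  finally show ?thesis by (simp add: has_field_derivative_def)
qed

lemma has_vector_derivative_vector_2:
  assumes "(f has_real_derivative f') (at x)" "(g has_real_derivative g') (at x)"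
  shows "((\<lambda>x. vector [f x, g x] :: real^2) has_vector_derivative vector [f', g']) (at x)"
  unfolding vector_2_eq_axis
  using assms by (auto intro!: derivative_eq_intros)

lemma linear_vector_2:
  fixes F :: "real^2 \<Rightarrow> real"
  assumes "linear F"
  shows "F (vector [a, b]) = a * F (axis 1 1) + b * F (axis 2 1)"
  unfolding vector_2_eq_axis by (simp add: linear_add[OF assms] linear_scale[OF assms])

text \<open>
  The region under a graph is flattened by \<open>(x, \<eta>) \<mapsto> (x, \<eta> h(x))\<close>, and the field is transported by
  the Piola transform of this map: \<open>G1 = h F1\<close> and \<open>G2 = F2 - \<eta> h' F1\<close> satisfy \<open>div G = h div F\<close>.
  The factor \<open>h\<close> makes \<open>G1\<close> vanish on the sides \<open>x = l\<close> and \<open>x = r\<close>, even where the region ends in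
  a cusp, and \<open>G2\<close> is on \<open>\<eta> = 1\<close> the flux through the graph and on \<open>\<eta> = 0\<close> the second component
  at the bottom.
\<close>

lemma subgraph_divergence_theorem:
  fixes F1 F2 D :: "real^2 \<Rightarrow> real" and F1' F2' :: "real^2 \<Rightarrow> real^2 \<Rightarrow> real"
    and h h' :: "real \<Rightarrow> real" and l r :: real
  defines "\<Omega> \<equiv> fluid_domain l r h"
  assumes "l < r" and h: "continuous_on {l..r} h" and hl: "h l = 0" and hr: "h r = 0"
    and pos: "\<And>x. x \<in> {l<..<r} \<Longrightarrow> 0 < h x"
    and dh: "\<And>x. x \<in> {l<..<r} \<Longrightarrow> (h has_real_derivative h' x) (at x)"
    and h': "continuous_on {l..r} h'"
    and F1: "continuous_on (closure \<Omega>) F1" and F2: "continuous_on (closure \<Omega>) F2"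
    and D: "continuous_on (closure \<Omega>) D"
    and dF1: "\<And>z. z \<in> \<Omega> \<Longrightarrow> (F1 has_derivative F1' z) (at z)"
    and dF2: "\<And>z. z \<in> \<Omega> \<Longrightarrow> (F2 has_derivative F2' z) (at z)"
    and cF1: "\<And>v. continuous_on \<Omega> (\<lambda>z. F1' z v)"
    and div: "\<And>z. z \<in> \<Omega> \<Longrightarrow> F1' z (axis 1 1) + F2' z (axis 2 1) = D z"
  shows "integral \<Omega> D
       = integral {l..r} (\<lambda>x. F2 (surface_point h x) - h' x * F1 (surface_point h x))
         - integral {l..r} (\<lambda>x. F2 (bottom_point x))"
proof -
  define p where "p = (\<lambda>x \<eta>. vector [x, \<eta> * h x] :: real^2)"
  define G1 where "G1 = (\<lambda>x \<eta>. h x * F1 (p x \<eta>))"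
  define G2 where "G2 = (\<lambda>x \<eta>. F2 (p x \<eta>) - \<eta> * h' x * F1 (p x \<eta>))"
  \<comment> \<open>The partial derivative of \<open>G1\<close> in \<open>x\<close>, by the chain rule.\<close>
  define A where "A = (\<lambda>x \<eta>. h' x * F1 (p x \<eta>)
      + h x * (F1' (p x \<eta>) (axis 1 1) + \<eta> * h' x * F1' (p x \<eta>) (axis 2 1)))"
  have p: "p x \<eta> \<in> \<Omega>" if "x \<in> {l<..<r}" "\<eta> \<in> {0<..<1}" for x \<eta>
    using that pos[of x] by (auto simp: p_def \<Omega>_def fluid_domain_def)
  have strip: "continuous_on ({l..r} \<times> {0..1}) (\<lambda>q. f (p (fst q) (snd q)))"
    if "continuous_on (closure \<Omega>) f" for f :: "real^2 \<Rightarrow> real"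
    using continuous_on_strip[OF \<open>l < r\<close> h _ that[unfolded \<Omega>_def]] pos
    by (simp add: p_def split_beta)
  have fst_cont: "continuous_on ({l..r} \<times> {0..1}) (\<lambda>q :: real \<times> real. f (fst q))"
    if "continuous_on {l..r} f" for f :: "real \<Rightarrow> real"
    by (rule continuous_on_compose2[OF that]) (auto intro!: continuous_intros)
  have "integral \<Omega> D = integral {l..r} (\<lambda>x. integral {0..1} (\<lambda>\<eta>. h x * D (p x \<eta>)))"
    unfolding \<Omega>_def p_def by (rule integral_fluid_domain) (use assms in auto)
  also have "\<dots> = integral {0..1} (\<lambda>\<eta>. G1 r \<eta> - G1 l \<eta>) + integral {l..r} (\<lambda>x. G2 x 1 - G2 x 0)"
  proof (rule rectangle_divergence_theorem[where A = A])
    show "continuous_on ({l..r} \<times> {0..1}) (\<lambda>(x, \<eta>). G1 x \<eta>)"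
      unfolding split_beta G1_def by (intro continuous_intros strip F1 fst_cont h)
    show "continuous_on ({l..r} \<times> {0..1}) (\<lambda>(x, \<eta>). G2 x \<eta>)"
      unfolding split_beta G2_def by (intro continuous_intros strip F1 F2 fst_cont h')
    show "continuous_on ({l..r} \<times> {0..1}) (\<lambda>(x, \<eta>). h x * D (p x \<eta>))"
      unfolding split_beta by (intro continuous_intros strip D fst_cont h)
    show "continuous_on ({l<..<r} \<times> {0<..<1}) (\<lambda>(x, \<eta>). A x \<eta>)"
    proof -
      let ?R = "{l<..<r} \<times> {0<..<1::real}"
      have sub: "?R \<subseteq> {l..r} \<times> {0..1}" by auto
      have "continuous_on ?R (\<lambda>q. p (fst q) (snd q))"
        unfolding p_def
        by (intro continuous_intros continuous_on_subset[OF fst_cont[OF h] sub])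
      then have F1'p: "continuous_on ?R (\<lambda>q. F1' (p (fst q) (snd q)) v)" for v
        by (rule continuous_on_compose2[OF cF1]) (use p in auto)
      show ?thesis
        unfolding split_beta A_def
        by (intro continuous_intros F1'p continuous_on_subset[OF fst_cont[OF h] sub]
              continuous_on_subset[OF fst_cont[OF h'] sub] continuous_on_subset[OF strip[OF F1] sub])
    qed
    fix x \<eta> :: real assume x: "x \<in> {l<..<r}" and \<eta>: "\<eta> \<in> {0<..<1}"
    note pO = p[OF x \<eta>]
    have lin: "linear (F1' (p x \<eta>))" "linear (F2' (p x \<eta>))"
      using has_derivative_linear dF1[OF pO] dF2[OF pO] by auto
    have "((\<lambda>x. p x \<eta>) has_vector_derivative vector [1, \<eta> * h' x]) (at x)"
      unfolding p_def by (intro has_vector_derivative_vector_2) (auto intro!: derivative_eq_intros dh x)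
    from has_real_derivative_along_curve[OF this dF1[OF pO]]
    have "((\<lambda>x. F1 (p x \<eta>)) has_real_derivative
            F1' (p x \<eta>) (axis 1 1) + \<eta> * h' x * F1' (p x \<eta>) (axis 2 1)) (at x)"
      by (simp add: linear_vector_2 lin)
    then show "((\<lambda>x. G1 x \<eta>) has_real_derivative A x \<eta>) (at x)"
      unfolding G1_def A_def by (auto intro!: derivative_eq_intros dh x)
    have p\<eta>: "(p x has_vector_derivative vector [0, h x]) (at \<eta>)"
      unfolding p_def by (intro has_vector_derivative_vector_2) (auto intro!: derivative_eq_intros)
    have "((\<lambda>\<eta>. F1 (p x \<eta>)) has_real_derivative h x * F1' (p x \<eta>) (axis 2 1)) (at \<eta>)"
      "((\<lambda>\<eta>. F2 (p x \<eta>)) has_real_derivative h x * F2' (p x \<eta>) (axis 2 1)) (at \<eta>)"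
      using has_real_derivative_along_curve[OF p\<eta> dF1[OF pO]]
        has_real_derivative_along_curve[OF p\<eta> dF2[OF pO]]
      by (simp_all add: linear_vector_2 lin)
    then show "(G2 x has_real_derivative h x * D (p x \<eta>) - A x \<eta>) (at \<eta>)"
      unfolding G2_def A_def div[OF pO, symmetric]
      by (auto intro!: derivative_eq_intros simp: algebra_simps)
  qed (use \<open>l < r\<close> in auto)
  also have "\<dots> = integral {l..r} (\<lambda>x. G2 x 1 - G2 x 0)"
    by (simp add: G1_def hl hr)
  also have "\<dots> = integral {l..r} (\<lambda>x. (F2 (surface_point h x) - h' x * F1 (surface_point h x))
                      - F2 (bottom_point x))"
    by (simp add: G2_def p_def surface_point_def bottom_point_def)
  also have "\<dots> = integral {l..r} (\<lambda>x. F2 (surface_point h x) - h' x * F1 (surface_point h x))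
         - integral {l..r} (\<lambda>x. F2 (bottom_point x))"
  proof (intro Henstock_Kurzweil_Integration.integral_diff integrable_continuous_real)
    have edge: "continuous_on {l..r} (\<lambda>x. f (vector [x, \<eta> * h x]))"
      if "continuous_on (closure \<Omega>) f" "\<eta> \<in> {0..1}" for f :: "real^2 \<Rightarrow> real" and \<eta>
      using continuous_on_slices(2)[of "{l..r}" "{0..1}" "\<lambda>x \<eta>. f (p x \<eta>)" \<eta>] strip[OF that(1)] that(2)
      by (simp add: split_beta p_def)
    show "continuous_on {l..r} (\<lambda>x. F2 (surface_point h x) - h' x * F1 (surface_point h x))"
      using edge[OF F1, of 1] edge[OF F2, of 1] by (auto intro!: continuous_intros h' simp: surface_point_def)
    show "continuous_on {l..r} (\<lambda>x. F2 (bottom_point x))"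
      using edge[OF F2, of 0] by (simp add: bottom_point_def)
  qed
  finally show ?thesis .
qed

section \<open>The power balance of the Stokes flow\<close>

lemma C1_uptoD:
  assumes "C1_upto U K f"
  shows "continuous_on K f"
    and "\<And>z. z \<in> U \<Longrightarrow> (f has_derivative frechet_derivative f (at z)) (at z)"
    and "\<And>v. \<exists>G. continuous_on K G \<and> (\<forall>z\<in>U. G z = frechet_derivative f (at z) v)"
  using assms by (auto simp: C1_upto_def frechet_derivative_works)

lemma C1_upto_continuous_frechet_derivative:
  assumes "C1_upto U U f"
  shows "continuous_on U (\<lambda>z. frechet_derivative f (at z) v)"
proof -
  obtain G where "continuous_on U G" "\<And>z. z \<in> U \<Longrightarrow> G z = frechet_derivative f (at z) v"
    using C1_uptoD(3)[OF assms, of v] by blast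
  then show ?thesis
    by (rule continuous_on_eq)
qed

lemma linear_transpose: "linear (transpose :: real^'n^'m \<Rightarrow> real^'m^'n)"
  by (rule linearI) (simp_all add: transpose_def vec_eq_iff)

lemma has_derivative_vec_nth:
  "(f has_derivative f') F \<Longrightarrow> ((\<lambda>x. f x $ i) has_derivative (\<lambda>v. f' v $ i)) F"
  by (rule bounded_linear.has_derivative[OF bounded_linear_vec_nth])

lemma trace_jacobian_2:
  fixes f :: "real^2 \<Rightarrow> real^2"
  assumes "(f has_derivative f') (at z)"
  shows "trace (jacobian f (at z)) = f' (axis 1 1) $ 1 + f' (axis 2 1) $ 2"
  using frechet_derivative_at[OF assms]
  by (simp add: jacobian_def matrix_def trace_def sum_2)

lemma norm_real_2_2_squared:
  fixes M :: "real^2^2"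
  shows "(norm M)\<^sup>2 = (M $ 1 $ 1)\<^sup>2 + (M $ 1 $ 2)\<^sup>2 + (M $ 2 $ 1)\<^sup>2 + (M $ 2 $ 2)\<^sup>2"
  by (simp add: norm_vec_def L2_set_def sum_2)

text \<open>
  Identifies the stress at the boundary, defined as a limit from inside the fluid, with the value
  of the continuous extension.
\<close>

lemma boundary_value_eq_Lim:
  assumes T: "continuous_on (closure \<Omega>) T" and eq: "\<And>z. z \<in> \<Omega> \<Longrightarrow> T z = S z"
    and "z \<in> closure \<Omega>" "z \<notin> \<Omega>"
  shows "Lim (at z within \<Omega>) S = (T z :: 'b::t2_space)"
proof (rule tendsto_Lim)
  show "\<not> trivial_limit (at z within \<Omega>)"
    using assms(3,4) by (simp add: closure_def trivial_limit_within)
  have "(T \<longlongrightarrow> T z) (at z within \<Omega>)"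
    using T assms(3) closure_subset by (auto simp: continuous_on intro: tendsto_within_subset)
  moreover have "\<forall>\<^sub>F w in at z within \<Omega>. T w = S w"
    using eq by (auto simp: eventually_at_filter)
  ultimately show "(S \<longlongrightarrow> T z) (at z within \<Omega>)"
    by (rule Lim_transform_eventually)
qed

text \<open>
  The Stokes equation is tested with the velocity itself.  For the field \<open>F = S u\<close> with the symmetric
  stress \<open>S\<close>, the momentum equation removes \<open>(\<nabla>\<cdot>S)\<cdot>u\<close> from \<open>div F\<close>, incompressibility removes the
  pressure, and \<open>div F = S : \<nabla>u = - \<mu>/2 |Du|\<^sup>2\<close> remains, where \<open>Du\<close> is the symmetric gradient.  By the
  divergence theorem its integral equals that of the outward flux \<open>u \<cdot> S \<nu>\<close>: the slip condition makes this
  \<open>\<beta> |u\<cdot>\<tau>|\<^sup>2\<close> at the bottom, and the dynamic condition turns it into \<open>q\<close> at the free surface.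
  The density \<open>q\<close> is taken from the continuous extension of \<open>F\<close>, hence continuous up to the contact
  points, where the dynamic condition says nothing.
\<close>

lemma stokes_power_balance:
  fixes u :: "real^2 \<Rightarrow> real^2" and P :: "real^2 \<Rightarrow> real" and h :: "real \<Rightarrow> real"
    and l r g \<sigma> \<mu> \<beta> :: real
  defines "\<Omega> \<equiv> fluid_domain l r h"
  assumes "l < r" and h: "continuous_on {l..r} h" and hl: "h l = 0" and hr: "h r = 0"
    and pos: "\<And>x. x \<in> {l<..<r} \<Longrightarrow> 0 < h x"
    and dh: "\<And>x. x \<in> {l<..<r} \<Longrightarrow> (h has_real_derivative slope l r h x) (at x)"
    and slope: "continuous_on {l..r} (slope l r h)"
    and u: "C1_upto \<Omega> (closure \<Omega>) u" and Ju: "C1_upto \<Omega> \<Omega> (\<lambda>z. jacobian u (at z))"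
    and P: "C1_upto \<Omega> \<Omega> P" and Pc: "continuous_on (closure \<Omega>) P"
    and stokes: "stokes_in_bulk \<mu> \<Omega> u P"
    and surface: "free_surface_condition g \<sigma> \<mu> l r h u P"
    and slip: "navier_slip_condition \<mu> \<beta> l r h u P"
  obtains q where "continuous_on {l..r} q"
    and "\<And>x. x \<in> {l<..<r} \<Longrightarrow> q x = (g * h x - \<sigma> * curvature l r h x)
           * (u (surface_point h x) $ 2 - slope l r h x * u (surface_point h x) $ 1)"
    and "integral {l..r} q + integral \<Omega> (\<lambda>z. \<mu> / 2 * (norm (sym_gradient u z))\<^sup>2)
         + integral {l..r} (\<lambda>x. \<beta> * \<bar>u (bottom_point x) \<bullet> bottom_tangent\<bar>\<^sup>2) = 0"
proof -
  have "open \<Omega>" unfolding \<Omega>_def by (rule open_fluid_domain[OF h])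
  have uc: "continuous_on (closure \<Omega>) u" by (rule C1_uptoD(1)[OF u])
  obtain G where Gc: "\<And>v. continuous_on (closure \<Omega>) (G v)"
    and G: "\<And>v z. z \<in> \<Omega> \<Longrightarrow> G v z = frechet_derivative u (at z) v"
    using C1_uptoD(3)[OF u] by metis
  \<comment> \<open>The continuous extension of the velocity gradient to the closed domain.\<close>
  define J :: "real^2 \<Rightarrow> real^2^2" where "J = (\<lambda>z. \<chi> i j. G (axis j 1) z $ i)"
  have J: "J z = jacobian u (at z)" if "z \<in> \<Omega>" for z
    using that by (simp add: J_def jacobian_def matrix_def G)
  have Jc: "continuous_on (closure \<Omega>) J"
    unfolding J_def by (intro continuous_intros Gc)
  have trc: "continuous_on X (\<lambda>z. transpose (f z))" if "continuous_on X f"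
    for X and f :: "real^2 \<Rightarrow> real^2^2"
    using that by (rule linear_continuous_on_compose) (rule linear_transpose)
  define T where "T = (\<lambda>z. P z *\<^sub>R mat 1 - \<mu> *\<^sub>R (J z + transpose (J z)))"
  have Tc: "continuous_on (closure \<Omega>) T"
    unfolding T_def by (intro continuous_intros Pc Jc trc)
  have T: "T z = stress \<mu> P u z" if "z \<in> \<Omega>" for z
    using that by (simp add: T_def stress_def sym_gradient_def J)
  have T_sym: "T z $ 2 $ 1 = T z $ 1 $ 2" for z
    by (simp add: T_def transpose_def mat_def)
  define D where "D = (\<lambda>z. - (\<mu> / 2 * (norm (J z + transpose (J z)))\<^sup>2))"
  have Dc: "continuous_on (closure \<Omega>) D"
    unfolding D_def by (intro continuous_intros Jc trc)
  define F where "F = (\<lambda>i z. T z $ i $ 1 * u z $ 1 + T z $ i $ 2 * u z $ 2)"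
  have Fc: "continuous_on (closure \<Omega>) (F i)" for i
    unfolding F_def by (intro continuous_intros Tc uc)
  let ?J' = "\<lambda>z. frechet_derivative (\<lambda>z. jacobian u (at z)) (at z)"
  define T' where "T' = (\<lambda>z v. frechet_derivative P (at z) v *\<^sub>R mat 1
                        - \<mu> *\<^sub>R (?J' z v + transpose (?J' z v)) :: real^2^2)"
  have T'c: "continuous_on \<Omega> (\<lambda>z. T' z v)" for v
    unfolding T'_def
    by (intro continuous_intros trc C1_upto_continuous_frechet_derivative P Ju)
  have T'_sym: "T' z v $ 2 $ 1 = T' z v $ 1 $ 2" for z v
    by (simp add: T'_def transpose_def mat_def)
  have stress': "(stress \<mu> P u has_derivative T' z) (at z)" if "z \<in> \<Omega>" for z
  proof -
    note dJ = C1_uptoD(2)[OF Ju that]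
    have "((\<lambda>z. transpose (jacobian u (at z))) has_derivative (\<lambda>v. transpose (?J' z v))) (at z)"
      by (rule bounded_linear.has_derivative[OF _ dJ])
         (use linear_transpose in \<open>simp add: linear_conv_bounded_linear\<close>)
    with dJ C1_uptoD(2)[OF P that] show ?thesis
      unfolding stress_def[abs_def] sym_gradient_def T'_def
      by (auto intro!: derivative_eq_intros simp: fun_eq_iff scaleR_diff_right)
  qed
  have dT: "(T has_derivative T' z) (at z)" if "z \<in> \<Omega>" for z
    using stress'[OF that] \<open>open \<Omega>\<close> that
    by (rule has_derivative_transform_within_open) (simp add: T)
  have du: "(u has_derivative (*v) (J z)) (at z)" if "z \<in> \<Omega>" for z
    using u that jacobian_works[of u "at z"] by (simp add: C1_upto_def J)
  define F' where "F' = (\<lambda>i z v. T z $ i $ 1 * (J z *v v) $ 1 + T' z v $ i $ 1 * u z $ 1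
                             + (T z $ i $ 2 * (J z *v v) $ 2 + T' z v $ i $ 2 * u z $ 2))"
  have dF: "(F i has_derivative F' i z) (at z)" if "z \<in> \<Omega>" for i z
    unfolding F_def F'_def
    by (intro has_derivative_add has_derivative_mult has_derivative_vec_nth dT du that)
  have F'c: "continuous_on \<Omega> (\<lambda>z. F' i z v)" for i v
    unfolding F'_def matrix_vector_mult_def
    by (intro continuous_intros T'c continuous_on_subset[OF Tc closure_subset]
          continuous_on_subset[OF uc closure_subset] continuous_on_subset[OF Jc closure_subset])
  have divF: "F' 1 z (axis 1 1) + F' 2 z (axis 2 1) = D z" if z: "z \<in> \<Omega>" for z
  proof -
    have "matrix_divergence (stress \<mu> P u) z = 0" and div_u: "divergence u z = 0"
      using stokes z by (auto simp: stokes_in_bulk_def)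
    then have divT: "T' z (axis 1 1) $ i $ 1 + T' z (axis 2 1) $ i $ 2 = 0" for i
      using trace_jacobian_2[OF has_derivative_vec_nth[OF stress'[OF z]], of i]
      by (simp add: matrix_divergence_def divergence_def vec_eq_iff)
    have tr: "J z $ 2 $ 2 = - J z $ 1 $ 1"
      using div_u unfolding divergence_def by (simp add: J[OF z] trace_def sum_2)
    have [simp]: "(J z *v axis j 1) $ i = J z $ i $ j" for i j
      by (simp add: matrix_vector_mult_basis column_def)
    \<comment> \<open>The first two lines are \<open>(\<nabla>\<cdot>S)\<cdot>u\<close>, the last one is \<open>S : \<nabla>u\<close>.\<close>
    have "F' 1 z (axis 1 1) + F' 2 z (axis 2 1)
        = (T' z (axis 1 1) $ 1 $ 1 + T' z (axis 2 1) $ 1 $ 2) * u z $ 1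
          + (T' z (axis 1 1) $ 2 $ 1 + T' z (axis 2 1) $ 2 $ 2) * u z $ 2
          + (T z $ 1 $ 1 * J z $ 1 $ 1 + T z $ 1 $ 2 * (J z $ 2 $ 1 + J z $ 1 $ 2) + T z $ 2 $ 2 * J z $ 2 $ 2)"
      using T_sym[of z] T'_sym[of z] by (simp add: F'_def algebra_simps)
    also have "\<dots> = T z $ 1 $ 1 * J z $ 1 $ 1 + T z $ 1 $ 2 * (J z $ 2 $ 1 + J z $ 1 $ 2) + T z $ 2 $ 2 * J z $ 2 $ 2"
      by (simp add: divT)
    also have "\<dots> = D z"
      unfolding D_def norm_real_2_2_squared T_def
      by (simp add: transpose_def mat_def tr power2_eq_square algebra_simps)
    finally show ?thesis .
  qed
  have bdry: "boundary_stress \<mu> \<Omega> P u z = T z" if "z \<in> closure \<Omega>" "z \<notin> \<Omega>" for z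
    unfolding boundary_stress_def by (rule boundary_value_eq_Lim[OF Tc T that])
  define q where "q = (\<lambda>x. F 2 (surface_point h x) - slope l r h x * F 1 (surface_point h x))"
  have cl: "surface_point h x \<in> closure \<Omega>" "bottom_point x \<in> closure \<Omega>" if "x \<in> {l..r}" for x
    using strip_subset_closure_fluid_domain[OF \<open>l < r\<close> h _ that, of 1]
      strip_subset_closure_fluid_domain[OF \<open>l < r\<close> h _ that, of 0] pos
    by (auto simp: surface_point_def bottom_point_def \<Omega>_def)
  have qc: "continuous_on {l..r} q"
  proof -
    have "continuous_on {l..r} (surface_point h)"
      unfolding surface_point_def[abs_def] by (intro continuous_intros h)
    then have "continuous_on {l..r} (\<lambda>x. F i (surface_point h x))" for i
      by (rule continuous_on_compose2[OF Fc]) (use cl in auto)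
    then show ?thesis
      unfolding q_def by (intro continuous_intros slope)
  qed
  have q: "q x = (g * h x - \<sigma> * curvature l r h x)
           * (u (surface_point h x) $ 2 - slope l r h x * u (surface_point h x) $ 1)"
    if x: "x \<in> {l<..<r}" for x
  proof -
    let ?z = "surface_point h x" and ?m = "slope l r h x"
    let ?\<kappa> = "g * h x - \<sigma> * curvature l r h x" and ?s = "1 / sqrt (1 + (slope l r h x)\<^sup>2)"
    have "T ?z = boundary_stress \<mu> \<Omega> P u ?z"
      using x cl[of x] by (subst bdry) (auto simp: \<Omega>_def fluid_domain_def surface_point_def)
    then have "T ?z *v surface_normal l r h x = ?\<kappa> *\<^sub>R surface_normal l r h x"
      using surface x unfolding free_surface_condition_def \<Omega>_def
      by (simp add: scaleR_left_diff_distrib)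
    then have "T ?z *v (?s *\<^sub>R vector [- ?m, 1]) = ?\<kappa> *\<^sub>R (?s *\<^sub>R vector [- ?m, 1])"
      unfolding surface_normal_def .
    \<comment> \<open>Only the direction \<open>(- h', 1)\<close> of the normal enters, so its normalising factor is cancelled.\<close>
    then have "?s *\<^sub>R (T ?z *v vector [- ?m, 1]) = ?s *\<^sub>R (?\<kappa> *\<^sub>R vector [- ?m, 1])"
      by (simp add: matrix_vector_mult_scaleR mult.commute)
    moreover have "?s \<noteq> 0"
      by (simp add: add_nonneg_eq_0_iff)
    ultimately have "T ?z *v vector [- ?m, 1] = ?\<kappa> *\<^sub>R vector [- ?m, 1]"
      by (metis scaleR_left_imp_eq)
    then have 1: "T ?z $ 1 $ 2 - ?m * T ?z $ 1 $ 1 = - ?\<kappa> * ?m"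
      and 2: "T ?z $ 2 $ 2 - ?m * T ?z $ 1 $ 2 = ?\<kappa>"
      by (auto simp: vec_eq_iff forall_2 matrix_vector_mult_def sum_2 T_sym algebra_simps)
    have "q x = (T ?z $ 1 $ 2 - ?m * T ?z $ 1 $ 1) * u ?z $ 1 + (T ?z $ 2 $ 2 - ?m * T ?z $ 1 $ 2) * u ?z $ 2"
      by (simp add: q_def F_def T_sym algebra_simps)
    also have "\<dots> = ?\<kappa> * (u ?z $ 2 - ?m * u ?z $ 1)"
      unfolding 1 2 by (simp add: algebra_simps)
    finally show ?thesis .
  qed
  have bottom: "F 2 (bottom_point x) = - (\<beta> * \<bar>u (bottom_point x) \<bullet> bottom_tangent\<bar>\<^sup>2)"
    if x: "x \<in> {l<..<r}" for x
  proof -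
    let ?z = "bottom_point x"
    have "T ?z = boundary_stress \<mu> \<Omega> P u ?z"
      using x cl[of x] by (subst bdry) (auto simp: \<Omega>_def fluid_domain_def bottom_point_def)
    with slip x have "(T ?z *v bottom_normal - \<beta> *\<^sub>R u ?z) \<bullet> bottom_tangent = 0"
      and "u ?z \<bullet> bottom_normal = 0"
      unfolding navier_slip_condition_def \<Omega>_def by auto
    then have "T ?z $ 1 $ 2 = - \<beta> * u ?z $ 1" "u ?z $ 2 = 0"
      by (auto simp: inner_vec_def sum_2 matrix_vector_mult_def bottom_normal_def bottom_tangent_def)
    then show ?thesis
      by (simp add: F_def T_sym inner_vec_def sum_2 bottom_tangent_def power2_eq_square)
  qed
  have "integral \<Omega> D = integral {l..r} q - integral {l..r} (\<lambda>x. F 2 (bottom_point x))"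
    unfolding q_def \<Omega>_def
    by (rule subgraph_divergence_theorem[where F1' = "F' 1" and F2' = "F' 2"])
       (use assms Fc Dc dF F'c divF in \<open>auto simp: \<Omega>_def\<close>)
  moreover have "integral \<Omega> D = - integral \<Omega> (\<lambda>z. \<mu> / 2 * (norm (sym_gradient u z))\<^sup>2)"
  proof -
    have "integral \<Omega> D = integral \<Omega> (\<lambda>z. - (\<mu> / 2 * (norm (sym_gradient u z))\<^sup>2))"
      by (rule integral_cong) (simp add: D_def sym_gradient_def J)
    then show ?thesis by (simp only: integral_neg)
  qed
  moreover have "integral {l..r} (\<lambda>x. F 2 (bottom_point x))
      = - integral {l..r} (\<lambda>x. \<beta> * \<bar>u (bottom_point x) \<bullet> bottom_tangent\<bar>\<^sup>2)"
  proof -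
    have "integral {l..r} (\<lambda>x. F 2 (bottom_point x))
        = integral {l..r} (\<lambda>x. - (\<beta> * \<bar>u (bottom_point x) \<bullet> bottom_tangent\<bar>\<^sup>2))"
      \<comment> \<open>The slip condition says nothing at the two contact points.\<close>
      by (rule integral_spike[of "{l, r}"]) (use bottom in auto)
    then show ?thesis by (simp only: integral_neg)
  qed
  ultimately show ?thesis
    using that[OF qc q] by simp
qed

section \<open>Time derivatives over a moving interval\<close>

text \<open>
  A derivative in the parameter \<open>s\<close> known for interior \<open>y\<close> extends to the endpoints: the increments
  \<open>f(\<sigma>, y) - f(c, y) = \<integral>\<^sub>c\<^sup>\<sigma> f'(\<tau>, y) d\<tau>\<close> survive the limit in \<open>y\<close>, and can then be differentiated again.
  It yields the rate of change of the height and the slope along the contact points, where both are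
  controlled only from inside the interval.
\<close>

lemma has_real_derivative_up_to_endpoints:
  fixes f f' :: "real \<Rightarrow> real \<Rightarrow> real"
  assumes "open I" "a < b"
    and f: "continuous_on (I \<times> {a..b}) (\<lambda>(s, y). f s y)"
    and f': "continuous_on (I \<times> {a..b}) (\<lambda>(s, y). f' s y)"
    and deriv: "\<And>s y. s \<in> I \<Longrightarrow> y \<in> {a<..<b} \<Longrightarrow> ((\<lambda>s. f s y) has_real_derivative f' s y) (at s)"
    and s: "s \<in> I" and y: "y \<in> {a..b}"
  shows "((\<lambda>s. f s y) has_real_derivative f' s y) (at s)"
proof -
  obtain e where e: "e > 0" "cball s e \<subseteq> I"
    using \<open>open I\<close> s open_contains_cball by blast
  define c d where "c = s - e" and "d = s + e"
  have cd: "c < s" "s < d" "{c..d} \<subseteq> I"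
    using e by (auto simp: c_def d_def cball_eq_atLeastAtMost)
  have incr: "f \<sigma> y - f c y - integral {c..\<sigma>} (\<lambda>\<tau>. f' \<tau> y) = 0" if \<sigma>: "\<sigma> \<in> {c..d}" for \<sigma>
  proof -
    have I: "{c..\<sigma>} \<subseteq> I" "\<sigma> \<in> I" "c \<in> I" using \<sigma> cd by auto
    have "continuous_on ({c..\<sigma>} \<times> {a..b}) (\<lambda>(\<tau>, y). f' \<tau> y)"
      by (rule continuous_on_subset[OF f']) (use I in auto)
    note sw = continuous_on_swap_arguments[OF this]
    show ?thesis
    proof (rule continuous_constant_on_closure[of "{a<..<b}" _ 0 y])
      show "continuous_on (closure {a<..<b}) (\<lambda>y. f \<sigma> y - f c y - integral {c..\<sigma>} (\<lambda>\<tau>. f' \<tau> y))"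
        using \<open>a < b\<close> I
        by (auto intro!: continuous_intros continuous_on_integral_interval[OF sw]
              continuous_on_slices(1)[OF f])
      show "y \<in> closure {a<..<b}" using \<open>a < b\<close> y by simp
      fix y assume y: "y \<in> {a<..<b}"
      have "((\<lambda>\<tau>. f' \<tau> y) has_integral f \<sigma> y - f c y) {c..\<sigma>}"
      proof (rule fundamental_theorem_of_calculus)
        fix \<tau> assume "\<tau> \<in> {c..\<sigma>}"
        then have "((\<lambda>s. f s y) has_real_derivative f' \<tau> y) (at \<tau>)"
          using I by (intro deriv y) auto
        then show "((\<lambda>s. f s y) has_vector_derivative f' \<tau> y) (at \<tau> within {c..\<sigma>})"
          by (simp add: has_real_derivative_iff_has_vector_derivative has_vector_derivative_at_within)
      qed (use \<sigma> in simp)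
      then show "f \<sigma> y - f c y - integral {c..\<sigma>} (\<lambda>\<tau>. f' \<tau> y) = 0"
        by (simp add: integral_unique)
    qed
  qed
  have "continuous_on {c..d} (\<lambda>\<tau>. f' \<tau> y)"
    using continuous_on_slices(2)[OF f' y] cd(3) by (rule continuous_on_subset)
  then have "((\<lambda>\<sigma>. integral {c..\<sigma>} (\<lambda>\<tau>. f' \<tau> y)) has_vector_derivative f' s y) (at s within {c..d})"
    by (rule integral_has_vector_derivative) (use cd in simp)
  from has_vector_derivative_add[OF has_vector_derivative_const this]
  have "((\<lambda>\<sigma>. f c y + integral {c..\<sigma>} (\<lambda>\<tau>. f' \<tau> y)) has_vector_derivative f' s y) (at s within {c..d})"
    by simp
  then have "((\<lambda>\<sigma>. f \<sigma> y) has_vector_derivative f' s y) (at s within {c..d})"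
  proof (rule has_vector_derivative_transform[rotated 2])
    fix \<sigma> assume "\<sigma> \<in> {c..d}"
    from incr[OF this] show "f \<sigma> y = f c y + integral {c..\<sigma>} (\<lambda>\<tau>. f' \<tau> y)"
      by simp
  qed (use cd in simp)
  then show ?thesis
    using cd at_within_Icc_at[of c s d] by (simp add: has_real_derivative_iff_has_vector_derivative)
qed

lemma has_real_derivative_integral_parameter:
  fixes f f' :: "real \<Rightarrow> real \<Rightarrow> real"
  assumes "open I" and s: "s \<in> I"
    and f: "continuous_on (I \<times> {a..b}) (\<lambda>(s, y). f s y)"
    and f': "continuous_on (I \<times> {a..b}) (\<lambda>(s, y). f' s y)"
    and deriv: "\<And>s y. s \<in> I \<Longrightarrow> y \<in> {a..b} \<Longrightarrow> ((\<lambda>s. f s y) has_real_derivative f' s y) (at s)"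
  shows "((\<lambda>s. integral {a..b} (f s)) has_real_derivative integral {a..b} (f' s)) (at s)"
proof -
  obtain e where e: "e > 0" "ball s e \<subseteq> I"
    using \<open>open I\<close> s open_contains_ball by blast
  have "((\<lambda>s. integral (cbox a b) (f s)) has_field_derivative integral (cbox a b) (f' s))
          (at s within ball s e)"
  proof (rule leibniz_rule_field_derivative)
    show "((\<lambda>s. f s y) has_real_derivative f' \<sigma> y) (at \<sigma> within ball s e)"
      if "\<sigma> \<in> ball s e" "y \<in> cbox a b" for \<sigma> y
      by (rule has_field_derivative_at_within, rule deriv) (use that e in auto)
    show "f \<sigma> integrable_on cbox a b" if "\<sigma> \<in> ball s e" for \<sigma>
      using continuous_on_slices(1)[OF f, of \<sigma>] e that by (auto intro!: integrable_continuous_real)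
    show "continuous_on (ball s e \<times> cbox a b) (\<lambda>(s, y). f' s y)"
      by (rule continuous_on_subset[OF f']) (use e in auto)
  qed (use e in auto)
  then show ?thesis
    using e by (simp add: at_within_open[of s "ball s e"])
qed

lemma convex_combination_mem_Icc:
  fixes l r \<theta> :: real
  assumes "l \<le> r" "\<theta> \<in> {0..1}"
  shows "l + \<theta> * (r - l) \<in> {l..r}"
  using assms mult_right_mono[of \<theta> 1 "r - l"] by simp

lemma convex_combination_mem_Ioo:
  fixes l r \<theta> :: real
  assumes "l < r" "\<theta> \<in> {0<..<1}"
  shows "l + \<theta> * (r - l) \<in> {l<..<r}"
proof -
  have "\<theta> * (r - l) < 1 * (r - l)"
    by (rule mult_strict_right_mono) (use assms in auto)
  then have "\<theta> * (r - l) < r - l" by (simp only: mult_1)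
  moreover have "0 < \<theta> * (r - l)"
    using assms by simp
  ultimately show ?thesis
    unfolding greaterThanLessThan_iff by linarith
qed

lemma integral_unit_interval_pullback:
  fixes f :: "real \<Rightarrow> real"
  assumes "l < r" "continuous_on {l..r} f"
  shows "integral {l..r} f = integral {0..1} (\<lambda>\<theta>. (r - l) * f (l + \<theta> * (r - l)))"
proof -
  have "((\<lambda>\<theta>. (r - l) *\<^sub>R f (l + \<theta> * (r - l))) has_integral
          integral {l + 0 * (r - l)..l + 1 * (r - l)} f) {0..1}"
    using assms convex_combination_mem_Icc[of l r]
    by (intro has_integral_substitution[where c = l and d = r]) (auto intro!: derivative_eq_intros)
  from integral_unique[OF this] show ?thesis by simp
qed

lemma slope_eq_derivative:
  assumes "(h has_real_derivative m) (at x)" "l < x" "x < r"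
  shows "slope l r h x = m"
  unfolding slope_def
  using assms
  by (intro vector_derivative_within_cbox[of l r, unfolded cbox_interval])
     (auto simp: has_real_derivative_iff_has_vector_derivative[symmetric] intro: DERIV_subset)

text \<open>
  The third derivative, applied to the slope, is the formula \<open>h'' / (1 + h'\<^sup>2)\<^bsup>3/2\<^esup>\<close> for the curvature.
\<close>

lemma has_real_derivative_arclength_factor:
  fixes f :: "real \<Rightarrow> real"
  assumes "(f has_real_derivative f') (at x)"
  shows "((\<lambda>x. sqrt (1 + (f x)\<^sup>2)) has_real_derivative f x * f' / sqrt (1 + (f x)\<^sup>2)) (at x)"
    and "((\<lambda>x. 1 / sqrt (1 + (f x)\<^sup>2)) has_real_derivative
            - (f x * f') / sqrt (1 + (f x)\<^sup>2) ^ 3) (at x)"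
    and "((\<lambda>x. f x / sqrt (1 + (f x)\<^sup>2)) has_real_derivative f' / sqrt (1 + (f x)\<^sup>2) ^ 3) (at x)"
proof -
  define Q where "Q = sqrt (1 + (f x)\<^sup>2)"
  have pos: "1 + (f x)\<^sup>2 > 0" by (simp add: add_pos_nonneg)
  then have Q: "Q > 0" "Q\<^sup>2 = 1 + (f x)\<^sup>2" by (auto simp: Q_def)
  show 1: "((\<lambda>x. sqrt (1 + (f x)\<^sup>2)) has_real_derivative f x * f' / sqrt (1 + (f x)\<^sup>2)) (at x)"
    using assms pos by (auto intro!: derivative_eq_intros simp: field_simps)
  show "((\<lambda>x. 1 / sqrt (1 + (f x)\<^sup>2)) has_real_derivative
            - (f x * f') / sqrt (1 + (f x)\<^sup>2) ^ 3) (at x)"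
  proof (rule DERIV_cong[OF DERIV_divide[OF DERIV_const 1]])
    show "(0 * sqrt (1 + (f x)\<^sup>2) - 1 * (f x * f' / sqrt (1 + (f x)\<^sup>2)))
        / (sqrt (1 + (f x)\<^sup>2) * sqrt (1 + (f x)\<^sup>2)) = - (f x * f') / sqrt (1 + (f x)\<^sup>2) ^ 3"
      unfolding Q_def[symmetric] using Q(1) by (simp add: field_simps power3_eq_cube)
  qed (use Q in \<open>simp add: Q_def\<close>)
  show "((\<lambda>x. f x / sqrt (1 + (f x)\<^sup>2)) has_real_derivative f' / sqrt (1 + (f x)\<^sup>2) ^ 3) (at x)"
  proof (rule DERIV_cong[OF DERIV_divide[OF assms 1]])
    show "(f' * sqrt (1 + (f x)\<^sup>2) - f x * (f x * f' / sqrt (1 + (f x)\<^sup>2)))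
        / (sqrt (1 + (f x)\<^sup>2) * sqrt (1 + (f x)\<^sup>2)) = f' / sqrt (1 + (f x)\<^sup>2) ^ 3"
    proof -
      have "f' * Q - f x * (f x * f' / Q) = f' * (Q\<^sup>2 - (f x)\<^sup>2) / Q"
        using Q(1) by (simp add: field_simps power2_eq_square)
      also have "\<dots> = f' / Q" using Q(2) by simp
      finally show ?thesis
        unfolding Q_def[symmetric] using Q(1) by (simp add: power3_eq_cube)
    qed
  qed (use Q in \<open>simp add: Q_def\<close>)
qed

lemma continuous_on_moving_interval:
  fixes f :: "real \<times> real \<Rightarrow> 'a::topological_space" and L R :: "real \<Rightarrow> real"
  assumes L: "continuous_on I L" and R: "continuous_on I R"
    and LR: "\<And>s. s \<in> I \<Longrightarrow> L s \<le> R s"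
    and f: "continuous_on {(s, x). s \<in> I \<and> L s \<le> x \<and> x \<le> R s} f"
  shows "continuous_on (I \<times> {0..1}) (\<lambda>(s, \<theta>). f (s, L s + \<theta> * (R s - L s)))"
proof -
  have fst_cont: "continuous_on (I \<times> {0..1}) (\<lambda>q :: real \<times> real. g (fst q))"
    if "continuous_on I g" for g :: "real \<Rightarrow> real"
    by (rule continuous_on_compose2[OF that]) (auto intro!: continuous_intros)
  have "continuous_on (I \<times> {0..1}) (\<lambda>q. (fst q, L (fst q) + snd q * (R (fst q) - L (fst q))))"
    by (intro continuous_intros fst_cont L R)
  then show ?thesis
    unfolding split_beta
    by (rule continuous_on_compose2[OF f])
       (use LR convex_combination_mem_Icc in auto)
qed

text \<open>
  The interval \<open>[L(s), R(s)]\<close> is parametrised over the fixed interval \<open>[0, 1]\<close> by \<open>\<theta> \<mapsto> L(s) + \<theta> (R(s) - L(s))\<close>.  In these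
  coordinates the time derivative contains the transport by the moving points, and it exists and is
  continuous on the closed interval, so that integrals over the moving interval can be
  differentiated under the integral sign.
\<close>

lemma moving_interval_time_derivative:
  fixes f :: "real \<times> real \<Rightarrow> real" and L R L' R' :: "real \<Rightarrow> real"
  assumes "open I"
    and dL: "\<And>s. s \<in> I \<Longrightarrow> (L has_real_derivative L' s) (at s)"
    and dR: "\<And>s. s \<in> I \<Longrightarrow> (R has_real_derivative R' s) (at s)"
    and L': "continuous_on I L'" and R': "continuous_on I R'"
    and LR: "\<And>s. s \<in> I \<Longrightarrow> L s < R s"
    and f: "C1_upto {(s, x). s \<in> I \<and> L s < x \<and> x < R s} {(s, x). s \<in> I \<and> L s \<le> x \<and> x \<le> R s} f"
  obtains f\<^sub>s f\<^sub>x where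
    "\<forall>s\<in>I. \<forall>x\<in>{L s<..<R s}. ((\<lambda>s. f (s, x)) has_real_derivative f\<^sub>s (s, x)) (at s)"
    "\<forall>s\<in>I. \<forall>x\<in>{L s<..<R s}. ((\<lambda>x. f (s, x)) has_real_derivative f\<^sub>x (s, x)) (at x)"
    "continuous_on (I \<times> {0..1}) (\<lambda>(s, \<theta>). f\<^sub>s (s, L s + \<theta> * (R s - L s))
        + f\<^sub>x (s, L s + \<theta> * (R s - L s)) * (L' s + \<theta> * (R' s - L' s)))"
    "\<forall>s\<in>I. \<forall>\<theta>\<in>{0..1}.
      ((\<lambda>s. f (s, L s + \<theta> * (R s - L s))) has_real_derivative
        f\<^sub>s (s, L s + \<theta> * (R s - L s))
          + f\<^sub>x (s, L s + \<theta> * (R s - L s)) * (L' s + \<theta> * (R' s - L' s))) (at s)"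
proof -
  let ?U = "{(s, x). s \<in> I \<and> L s < x \<and> x < R s}" and ?K = "{(s, x). s \<in> I \<and> L s \<le> x \<and> x \<le> R s}"
  let ?D = "\<lambda>p. frechet_derivative f (at p)"
  let ?X = "\<lambda>s \<theta>. L s + \<theta> * (R s - L s)" and ?X' = "\<lambda>s \<theta>. L' s + \<theta> * (R' s - L' s)"
  obtain f\<^sub>s where fs: "continuous_on ?K f\<^sub>s" "\<And>p. p \<in> ?U \<Longrightarrow> f\<^sub>s p = ?D p (1, 0)"
    using C1_uptoD(3)[OF f, of "(1, 0)"] by blast
  obtain f\<^sub>x where fx: "continuous_on ?K f\<^sub>x" "\<And>p. p \<in> ?U \<Longrightarrow> f\<^sub>x p = ?D p (0, 1)"
    using C1_uptoD(3)[OF f, of "(0, 1)"] by blast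
  have Lc: "continuous_on I L" and Rc: "continuous_on I R"
    by (rule DERIV_continuous_on, rule has_field_derivative_at_within, rule dL dR, assumption)+
  have LR': "L s \<le> R s" if "s \<in> I" for s using LR[OF that] by simp
  note pull = continuous_on_moving_interval[OF Lc Rc LR']
  have fst_cont: "continuous_on (I \<times> {0..1}) (\<lambda>q :: real \<times> real. g (fst q))"
    if "continuous_on I g" for g :: "real \<Rightarrow> real"
    by (rule continuous_on_compose2[OF that]) (auto intro!: continuous_intros)
  have d: "(f has_derivative ?D (s, x)) (at (s, x))" if "s \<in> I" "x \<in> {L s<..<R s}" for s x
    using C1_uptoD(2)[OF f, of "(s, x)"] that by simp
  have 1: "((\<lambda>s. f (s, x)) has_real_derivative f\<^sub>s (s, x)) (at s)"
    if "s \<in> I" "x \<in> {L s<..<R s}" for s x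
  proof -
    have "((\<lambda>s. (s, x)) has_vector_derivative (1, 0)) (at s)"
      by (auto intro!: derivative_eq_intros has_vector_derivative_Pair)
    from has_real_derivative_along_curve[OF this d[OF that]] show ?thesis
      using fs(2)[of "(s, x)"] that by simp
  qed
  have 2: "((\<lambda>x. f (s, x)) has_real_derivative f\<^sub>x (s, x)) (at x)"
    if "s \<in> I" "x \<in> {L s<..<R s}" for s x
  proof -
    have "((\<lambda>x. (s, x)) has_vector_derivative (0, 1)) (at x)"
      by (auto intro!: derivative_eq_intros has_vector_derivative_Pair)
    from has_real_derivative_along_curve[OF this d[OF that]] show ?thesis
      using fx(2)[of "(s, x)"] that by simp
  qed
  have 3: "continuous_on (I \<times> {0..1}) (\<lambda>(s, \<theta>). f\<^sub>s (s, ?X s \<theta>) + f\<^sub>x (s, ?X s \<theta>) * ?X' s \<theta>)"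
    using pull[OF _ fs(1)] pull[OF _ fx(1)] fst_cont[OF L'] fst_cont[OF R']
    unfolding split_beta by (auto intro!: continuous_intros)
  have 4: "((\<lambda>s. f (s, ?X s \<theta>)) has_real_derivative f\<^sub>s (s, ?X s \<theta>) + f\<^sub>x (s, ?X s \<theta>) * ?X' s \<theta>) (at s)"
    if "s \<in> I" "\<theta> \<in> {0..1}" for s \<theta>
  proof (rule has_real_derivative_up_to_endpoints[OF \<open>open I\<close> _ _ 3 _ that])
    show "continuous_on (I \<times> {0..1}) (\<lambda>(s, \<theta>). f (s, ?X s \<theta>))"
      by (rule pull[OF _ C1_uptoD(1)[OF f]])
    fix s \<theta> assume s: "s \<in> I" and \<theta>: "\<theta> \<in> {0<..<1::real}"
    have X: "?X s \<theta> \<in> {L s<..<R s}"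
      using LR[OF s] \<theta> by (intro convex_combination_mem_Ioo)
    have "((\<lambda>s. (s, ?X s \<theta>)) has_vector_derivative (1, ?X' s \<theta>)) (at s)"
      using dL[OF s] dR[OF s]
      by (auto intro!: derivative_eq_intros has_vector_derivative_Pair
           simp: has_real_derivative_iff_has_vector_derivative[symmetric])
    from has_real_derivative_along_curve[OF this d[OF s X]]
    have "((\<lambda>s. f (s, ?X s \<theta>)) has_real_derivative ?D (s, ?X s \<theta>) (1, ?X' s \<theta>)) (at s)" .
    also have "(1, ?X' s \<theta>) = (1, 0) + ?X' s \<theta> *\<^sub>R (0, 1)" by simp
    also have "?D (s, ?X s \<theta>) \<dots> = ?D (s, ?X s \<theta>) (1, 0) + ?X' s \<theta> * ?D (s, ?X s \<theta>) (0, 1)"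
      using has_derivative_linear[OF d[OF s X]] by (simp only: linear_add linear_scale real_scaleR_def)
    finally show "((\<lambda>s. f (s, ?X s \<theta>)) has_real_derivative f\<^sub>s (s, ?X s \<theta>) + f\<^sub>x (s, ?X s \<theta>) * ?X' s \<theta>) (at s)"
      using fs(2)[of "(s, ?X s \<theta>)"] fx(2)[of "(s, ?X s \<theta>)"] s X by (simp add: mult.commute)
  qed simp
  show ?thesis
    by (rule that[of f\<^sub>s f\<^sub>x]) (intro ballI 1 2 3 4; assumption)+
qed

section \<open>The first variation of the energy\<close>

text \<open>
  Over the fixed interval \<open>[0, 1]\<close> put \<open>X(s, \<theta>) = L + \<theta> w\<close> with \<open>w = R - L\<close>, and let \<open>Z\<close> and \<open>S\<close> be the
  height and the slope at \<open>X\<close>, \<open>Q = \<surd>(1 + S\<^sup>2)\<close>; the prime denotes the time derivative of \<open>X\<close> and \<open>w\<close>.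
  The energy density is \<open>w (g/2 Z\<^sup>2 + \<sigma> Q)\<close>, and its time derivative \<open>N\<close> is the power
  \<open>w q\<close> of the surface forces plus an exact derivative \<open>\<partial>\<^sub>\<theta> M\<close>, where
  \<open>M = g/2 Z\<^sup>2 X' + \<sigma> (S/Q \<partial>\<^sub>s Z + X'/Q)\<close>: the three terms collect the transport of potential energy, the
  integration by parts that produces the curvature, and the transport of surface energy.  The height
  vanishes at the contact points at all times, so \<open>Z\<close> and \<open>\<partial>\<^sub>s Z\<close> vanish for \<open>\<theta> = 0\<close> and \<open>\<theta> = 1\<close>,
  and of \<open>M\<close> only \<open>\<sigma> X'/Q\<close> remains there, which are the surface tension terms at \<open>L\<close> and \<open>R\<close>.
\<close>

lemma droplet_energy_derivative:
  fixes \<zeta> :: "real \<Rightarrow> real \<Rightarrow> real" and L R L' R' q :: "real \<Rightarrow> real"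
    and I :: "real set" and g \<sigma> \<gamma> t :: real
  defines "m \<equiv> \<lambda>s. slope (L s) (R s) (\<zeta> s)"
    and "U \<equiv> {(s, x). s \<in> I \<and> L s < x \<and> x < R s}"
    and "K \<equiv> {(s, x). s \<in> I \<and> L s \<le> x \<and> x \<le> R s}"
  assumes "open I" and t: "t \<in> I"
    and dL: "\<And>s. s \<in> I \<Longrightarrow> (L has_real_derivative L' s) (at s)"
    and dR: "\<And>s. s \<in> I \<Longrightarrow> (R has_real_derivative R' s) (at s)"
    and L': "continuous_on I L'" and R': "continuous_on I R'"
    and geom: "droplet_geometry I L R \<zeta>"
    and \<zeta>: "C1_upto U K (\<lambda>(s, x). \<zeta> s x)" and m: "C1_upto U K (\<lambda>(s, x). m s x)"
    and qc: "continuous_on {L t..R t} q"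
    and q: "\<And>x. x \<in> {L t<..<R t} \<Longrightarrow>
      q x = (g * \<zeta> t x - \<sigma> * curvature (L t) (R t) (\<zeta> t) x) * deriv (\<lambda>s. \<zeta> s x) t"
  shows "((\<lambda>s. integral {L s..R s} (\<lambda>x. g / 2 * (\<zeta> s x)\<^sup>2)
              + integral {L s..R s} (\<lambda>x. \<sigma> * sqrt (1 + (m s x)\<^sup>2)) - \<gamma> * (R s - L s))
          has_real_derivative
            integral {L t..R t} q + \<sigma> * (R' t / sqrt (1 + (m t (R t))\<^sup>2) - L' t / sqrt (1 + (m t (L t))\<^sup>2))
            - \<gamma> * (R' t - L' t)) (at t)"
proof -
  have LR: "L s < R s" and \<zeta>L: "\<zeta> s (L s) = 0" and \<zeta>R: "\<zeta> s (R s) = 0" if "s \<in> I" for s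
    using geom that by (auto simp: droplet_geometry_def)
  then have LR': "L s \<le> R s" if "s \<in> I" for s using that by force
  define w w' where "w = (\<lambda>s. R s - L s)" and "w' = (\<lambda>s. R' s - L' s)"
  define X X' where "X = (\<lambda>s \<theta>. L s + \<theta> * w s)" and "X' = (\<lambda>s \<theta>. L' s + \<theta> * w' s)"
  define Z S where "Z = (\<lambda>s \<theta>. \<zeta> s (X s \<theta>))" and "S = (\<lambda>s \<theta>. m s (X s \<theta>))"
  note defs = X_def X'_def w_def w'_def
  obtain \<zeta>\<^sub>s \<zeta>\<^sub>x where
    \<zeta>s: "\<forall>s\<in>I. \<forall>x\<in>{L s<..<R s}. ((\<lambda>s. \<zeta> s x) has_real_derivative \<zeta>\<^sub>s (s, x)) (at s)" and
    \<zeta>x: "\<forall>s\<in>I. \<forall>x\<in>{L s<..<R s}. (\<zeta> s has_real_derivative \<zeta>\<^sub>x (s, x)) (at x)" and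
    Zsc: "continuous_on (I \<times> {0..1}) (\<lambda>(s, \<theta>). \<zeta>\<^sub>s (s, X s \<theta>) + \<zeta>\<^sub>x (s, X s \<theta>) * X' s \<theta>)" and
    dZs: "\<forall>s\<in>I. \<forall>\<theta>\<in>{0..1}.
      ((\<lambda>s. Z s \<theta>) has_real_derivative \<zeta>\<^sub>s (s, X s \<theta>) + \<zeta>\<^sub>x (s, X s \<theta>) * X' s \<theta>) (at s)"
  proof (rule moving_interval_time_derivative[OF \<open>open I\<close> dL dR L' R' LR \<zeta>[unfolded U_def K_def],
        unfolded case_prod_conv], goal_cases)
    case (4 f\<^sub>s f\<^sub>x)
    show thesis by (rule 4(1)[unfolded Z_def defs, OF 4(2-5)])
  qed
  obtain m\<^sub>s m\<^sub>x where
    "\<forall>s\<in>I. \<forall>x\<in>{L s<..<R s}. ((\<lambda>s. m s x) has_real_derivative m\<^sub>s (s, x)) (at s)" and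
    mx: "\<forall>s\<in>I. \<forall>x\<in>{L s<..<R s}. (m s has_real_derivative m\<^sub>x (s, x)) (at x)" and
    Ssc: "continuous_on (I \<times> {0..1}) (\<lambda>(s, \<theta>). m\<^sub>s (s, X s \<theta>) + m\<^sub>x (s, X s \<theta>) * X' s \<theta>)" and
    dSs: "\<forall>s\<in>I. \<forall>\<theta>\<in>{0..1}.
      ((\<lambda>s. S s \<theta>) has_real_derivative m\<^sub>s (s, X s \<theta>) + m\<^sub>x (s, X s \<theta>) * X' s \<theta>) (at s)"
  proof (rule moving_interval_time_derivative[OF \<open>open I\<close> dL dR L' R' LR m[unfolded U_def K_def],
        unfolded case_prod_conv], goal_cases)
    case (4 f\<^sub>s f\<^sub>x)
    show thesis by (rule 4(1)[unfolded S_def defs, OF 4(2-5)])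
  qed
  note \<zeta>s = \<zeta>s[rule_format] and \<zeta>x = \<zeta>x[rule_format] and mx = mx[rule_format]
  define Zs Ss where "Zs = (\<lambda>s \<theta>. \<zeta>\<^sub>s (s, X s \<theta>) + \<zeta>\<^sub>x (s, X s \<theta>) * X' s \<theta>)"
    and "Ss = (\<lambda>s \<theta>. m\<^sub>s (s, X s \<theta>) + m\<^sub>x (s, X s \<theta>) * X' s \<theta>)"
  have Zsc: "continuous_on (I \<times> {0..1}) (\<lambda>(s, \<theta>). Zs s \<theta>)"
    using Zsc by (simp add: Zs_def)
  have dZs: "((\<lambda>s. Z s \<theta>) has_real_derivative Zs s \<theta>) (at s)"
    if "s \<in> I" "\<theta> \<in> {0..1}" for s \<theta>
    using dZs that by (simp add: Zs_def)
  have Ssc: "continuous_on (I \<times> {0..1}) (\<lambda>(s, \<theta>). Ss s \<theta>)"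
    using Ssc by (simp add: Ss_def)
  have dSs: "((\<lambda>s. S s \<theta>) has_real_derivative Ss s \<theta>) (at s)"
    if "s \<in> I" "\<theta> \<in> {0..1}" for s \<theta>
    using dSs that by (simp add: Ss_def)
  have Lc: "continuous_on I L" and Rc: "continuous_on I R"
    by (rule DERIV_continuous_on, rule has_field_derivative_at_within, rule dL dR, assumption)+
  have wc: "continuous_on I w" "continuous_on I w'"
    unfolding w_def w'_def by (intro continuous_intros Lc Rc L' R')+
  have Zc: "continuous_on (I \<times> {0..1}) (\<lambda>(s, \<theta>). Z s \<theta>)"
    using continuous_on_moving_interval[OF Lc Rc LR' C1_uptoD(1)[OF \<zeta>, unfolded K_def]]
    by (simp add: Z_def defs)
  have Sc: "continuous_on (I \<times> {0..1}) (\<lambda>(s, \<theta>). S s \<theta>)"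
    using continuous_on_moving_interval[OF Lc Rc LR' C1_uptoD(1)[OF m, unfolded K_def]]
    by (simp add: S_def defs)
  have fst_cont: "continuous_on (I \<times> T) (\<lambda>p :: real \<times> real. f (fst p))"
    if "continuous_on I f" for f :: "real \<Rightarrow> real" and T
    by (rule continuous_on_compose2[OF that]) (auto intro!: continuous_intros)
  note pair_cont = Zc[unfolded split_beta] Sc[unfolded split_beta] Zsc[unfolded split_beta]
    Ssc[unfolded split_beta] wc[THEN fst_cont]
  have dw: "(w has_real_derivative w' s) (at s)" if "s \<in> I" for s
    unfolding w_def w'_def using dL[OF that] dR[OF that] by (auto intro!: derivative_eq_intros)
  have w_pos: "0 < w s" if "s \<in> I" for s
    using LR[OF that] by (simp add: w_def)
  have X_mem: "X s \<theta> \<in> {L s<..<R s}" if "s \<in> I" "\<theta> \<in> {0<..<1}" for s \<theta>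
    unfolding defs using that LR by (intro convex_combination_mem_Ioo) auto
  have \<zeta>x_eq: "\<zeta>\<^sub>x (s, x) = m s x" if "s \<in> I" "x \<in> {L s<..<R s}" for s x
    using slope_eq_derivative[OF \<zeta>x[OF that]] that by (simp add: m_def)
  have dX\<theta>: "(X s has_real_derivative w s) (at \<theta>)" for s \<theta>
    unfolding X_def by (auto intro!: derivative_eq_intros)
  have dZ\<theta>: "(Z s has_real_derivative w s * S s \<theta>) (at \<theta>)" if "s \<in> I" "\<theta> \<in> {0<..<1}" for s \<theta>
    using DERIV_chain2[OF \<zeta>x[OF that(1) X_mem[OF that]] dX\<theta>] \<zeta>x_eq[OF that(1) X_mem[OF that]]
    by (simp add: Z_def S_def mult.commute)
  have dS\<theta>: "(S s has_real_derivative w s * m\<^sub>x (s, X s \<theta>)) (at \<theta>)" if "s \<in> I" "\<theta> \<in> {0<..<1}" for s \<theta>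
    using DERIV_chain2[OF mx[OF that(1) X_mem[OF that]] dX\<theta>]
    by (simp add: S_def mult.commute)
  have Z0: "Z s 0 = 0" and Z1: "Z s 1 = 0" if "s \<in> I" for s
    using \<zeta>L[OF that] \<zeta>R[OF that] by (simp_all add: Z_def defs)
  have Zs0: "Zs s 0 = 0" and Zs1: "Zs s 1 = 0" if s: "s \<in> I" for s
  proof -
    have "((\<lambda>s. Z s \<theta>) has_real_derivative 0) (at s)" if "\<And>s. s \<in> I \<Longrightarrow> Z s \<theta> = 0" for \<theta>
      using DERIV_const[of 0 "at s"] \<open>open I\<close> s
      by (rule has_field_derivative_transform_within_open) (simp add: that)
    from DERIV_unique[OF dZs[OF s] this] show "Zs s 0 = 0" "Zs s 1 = 0"
      using Z0 Z1 by auto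
  qed
  \<comment> \<open>Integrating \<open>\<partial>\<^sub>\<theta> Z = w S\<close> from the contact point and differentiating in time shows that \<open>\<partial>\<^sub>s Z\<close> is
    differentiable in \<open>\<theta>\<close>: the mixed derivative exists and equals \<open>\<partial>\<^sub>s (w S)\<close>.\<close>
  have Zs_eq: "Zs t \<theta> = integral {0..\<theta>} (\<lambda>y. w' t * S t y + w t * Ss t y)" if \<theta>: "\<theta> \<in> {0..1}" for \<theta>
  proof -
    have sub: "I \<times> {0..\<theta>} \<subseteq> I \<times> {0..1}" using \<theta> by auto
    note pair_cont' = pair_cont[THEN continuous_on_subset[OF _ sub]]
    have D: "((\<lambda>s. integral {0..\<theta>} (\<lambda>y. w s * S s y)) has_real_derivative
            integral {0..\<theta>} (\<lambda>y. w' t * S t y + w t * Ss t y)) (at t)"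
    proof (rule has_real_derivative_integral_parameter[OF \<open>open I\<close> t])
      show "continuous_on (I \<times> {0..\<theta>}) (\<lambda>(s, y). w s * S s y)"
        "continuous_on (I \<times> {0..\<theta>}) (\<lambda>(s, y). w' s * S s y + w s * Ss s y)"
        unfolding split_beta by (intro continuous_intros pair_cont')+
      show "((\<lambda>s. w s * S s y) has_real_derivative w' s * S s y + w s * Ss s y) (at s)"
        if "s \<in> I" "y \<in> {0..\<theta>}" for s y
        using DERIV_mult[OF dw[OF that(1)] dSs[of s y]] that \<theta> by (simp add: mult.commute add.commute)
    qed
    have eq: "integral {0..\<theta>} (\<lambda>y. w s * S s y) = Z s \<theta>" if s: "s \<in> I" for s
    proof -
      have "continuous_on {0..\<theta>} (Z s)"
        using continuous_on_slices(1)[OF Zc s] by (rule continuous_on_subset) (use \<theta> in auto)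
      then have "((\<lambda>y. w s * S s y) has_integral Z s \<theta> - Z s 0) {0..\<theta>}"
        using dZ\<theta>[OF s] \<theta>
        by (intro fundamental_theorem_of_calculus_interior)
           (auto simp: has_real_derivative_iff_has_vector_derivative[symmetric])
      from integral_unique[OF this] show ?thesis using Z0[OF s] by simp
    qed
    show ?thesis
      by (rule DERIV_unique[OF dZs[OF t \<theta>]
            has_field_derivative_transform_within_open[OF D \<open>open I\<close> t eq]])
  qed
  have slice: "continuous_on {0..1} (f t)" if "continuous_on (I \<times> {0..1}) (\<lambda>(s, y). f s y)"
    for f :: "real \<Rightarrow> real \<Rightarrow> real"
    by (rule continuous_on_slices(1)[OF that t])
  have dZs\<theta>: "(Zs t has_real_derivative w' t * S t \<theta> + w t * Ss t \<theta>) (at \<theta>)"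
    if \<theta>: "\<theta> \<in> {0<..<1}" for \<theta>
  proof -
    have "continuous_on {0..1} (\<lambda>y. w' t * S t y + w t * Ss t y)"
      by (intro continuous_intros slice[of S, OF Sc] slice[of Ss, OF Ssc])
    then have "((\<lambda>\<theta>. integral {0..\<theta>} (\<lambda>y. w' t * S t y + w t * Ss t y)) has_vector_derivative
        w' t * S t \<theta> + w t * Ss t \<theta>) (at \<theta> within {0..1})"
      by (rule integral_has_vector_derivative) (use \<theta> in simp)
    then have "(Zs t has_vector_derivative w' t * S t \<theta> + w t * Ss t \<theta>) (at \<theta> within {0..1})"
      by (rule has_vector_derivative_transform[rotated 2]) (use \<theta> Zs_eq in simp_all)
    then show ?thesis
      using \<theta> at_within_Icc_at[of 0 \<theta> 1] by (simp add: has_real_derivative_iff_has_vector_derivative)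
  qed
  define Q where "Q = (\<lambda>s \<theta>. sqrt (1 + (S s \<theta>)\<^sup>2))"
  have Q_pos: "Q s \<theta> > 0" and Q_sq: "(Q s \<theta>)\<^sup>2 = 1 + (S s \<theta>)\<^sup>2" for s \<theta>
    by (auto simp: Q_def add_pos_nonneg)
  have Q_nz: "Q s \<theta> \<noteq> 0" for s \<theta> using Q_pos[of s \<theta>] by simp
  have Qc: "continuous_on (I \<times> {0..1}) (\<lambda>p. Q (fst p) (snd p))"
    unfolding Q_def by (intro continuous_intros pair_cont)
  define N where "N = (\<lambda>s \<theta>. w' s * (g / 2 * (Z s \<theta>)\<^sup>2 + \<sigma> * Q s \<theta>)
      + w s * (g * Z s \<theta> * Zs s \<theta> + \<sigma> * (S s \<theta> * Ss s \<theta> / Q s \<theta>)))"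
  have dE: "((\<lambda>s. integral {0..1} (\<lambda>\<theta>. w s * (g / 2 * (Z s \<theta>)\<^sup>2 + \<sigma> * Q s \<theta>)))
      has_real_derivative integral {0..1} (N t)) (at t)"
  proof (rule has_real_derivative_integral_parameter[OF \<open>open I\<close> t])
    show "continuous_on (I \<times> {0..1}) (\<lambda>(s, \<theta>). w s * (g / 2 * (Z s \<theta>)\<^sup>2 + \<sigma> * Q s \<theta>))"
      unfolding split_beta by (intro continuous_intros pair_cont Qc)
    show "continuous_on (I \<times> {0..1}) (\<lambda>(s, \<theta>). N s \<theta>)"
      unfolding split_beta N_def by (intro continuous_intros pair_cont Qc ballI Q_nz)
    fix s \<theta> :: real assume s: "s \<in> I" and \<theta>: "\<theta> \<in> {0..1}"
    have "((\<lambda>s. Q s \<theta>) has_real_derivative S s \<theta> * Ss s \<theta> / Q s \<theta>) (at s)"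
      using has_real_derivative_arclength_factor(1)[OF dSs[OF s \<theta>]] by (simp add: Q_def)
    note dQ = this
    have "((\<lambda>s. (Z s \<theta>)\<^sup>2) has_real_derivative 2 * Z s \<theta> * Zs s \<theta>) (at s)"
      using DERIV_power[OF dZs[OF s \<theta>], of 2] by (simp add: mult_ac)
    from DERIV_mult[OF dw[OF s] DERIV_add[OF DERIV_cmult[OF this, of "g / 2"] DERIV_cmult[OF dQ, of \<sigma>]]]
    have d: "((\<lambda>s. w s * (g / 2 * (Z s \<theta>)\<^sup>2 + \<sigma> * Q s \<theta>)) has_real_derivative
        w' s * (g / 2 * (Z s \<theta>)\<^sup>2 + \<sigma> * Q s \<theta>)
        + (g / 2 * (2 * Z s \<theta> * Zs s \<theta>) + \<sigma> * (S s \<theta> * Ss s \<theta> / Q s \<theta>)) * w s) (at s)" .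
    have "w' s * (g / 2 * (Z s \<theta>)\<^sup>2 + \<sigma> * Q s \<theta>)
        + (g / 2 * (2 * Z s \<theta> * Zs s \<theta>) + \<sigma> * (S s \<theta> * Ss s \<theta> / Q s \<theta>)) * w s = N s \<theta>"
      by (simp add: N_def)
    with d show "((\<lambda>s. w s * (g / 2 * (Z s \<theta>)\<^sup>2 + \<sigma> * Q s \<theta>)) has_real_derivative N s \<theta>) (at s)"
      by simp
  qed
  define M where "M = (\<lambda>\<theta>. g / 2 * (Z t \<theta>)\<^sup>2 * X' t \<theta>
      + \<sigma> * (S t \<theta> / Q t \<theta> * Zs t \<theta> + 1 / Q t \<theta> * X' t \<theta>))"
  have "((\<lambda>\<theta>. N t \<theta> - w t * q (X t \<theta>)) has_integral M 1 - M 0) {0..1}"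
  proof (rule fundamental_theorem_of_calculus_interior)
    have "continuous_on {0..1} (Q t)"
      using continuous_on_slices(1)[OF _ t, of "{0..1}" Q] Qc by (simp add: split_beta)
    then show "continuous_on {0..1} M"
      unfolding M_def X'_def
      by (intro continuous_intros slice[of Z, OF Zc] slice[of S, OF Sc] slice[of Zs, OF Zsc] ballI Q_nz)
    fix \<theta> :: real assume \<theta>: "\<theta> \<in> {0<..<1}"
    let ?x = "X t \<theta>" and ?Z = "Z t \<theta>" and ?S = "S t \<theta>" and ?Q = "Q t \<theta>" and ?Zs = "Zs t \<theta>"
    let ?k = "m\<^sub>x (t, X t \<theta>)"
    note x = X_mem[OF t \<theta>]
    have curv: "curvature (L t) (R t) (\<zeta> t) ?x = ?k / ?Q ^ 3"
      using has_real_derivative_arclength_factor(3)[OF mx[OF t x]]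
      unfolding curvature_def by (simp add: DERIV_imp_deriv m_def Q_def S_def)
    \<comment> \<open>The velocity of the surface at a fixed position differs from \<open>\<partial>\<^sub>s Z\<close> by the transport with \<open>X\<close>.\<close>
    have Zs_split: "\<zeta>\<^sub>s (t, ?x) = ?Zs - ?S * X' t \<theta>"
      by (simp add: Zs_def S_def \<zeta>x_eq[OF t x])
    have qx: "q ?x = (g * ?Z - \<sigma> * (?k / ?Q ^ 3)) * (?Zs - ?S * X' t \<theta>)"
      using q[OF x] DERIV_imp_deriv[OF \<zeta>s[OF t x]] by (simp add: curv Zs_split Z_def)
    have dX'\<theta>: "(X' t has_real_derivative w' t) (at \<theta>)"
      unfolding X'_def by (auto intro!: derivative_eq_intros)
    have dSQ: "((\<lambda>\<theta>. S t \<theta> / Q t \<theta>) has_real_derivative w t * ?k / ?Q ^ 3) (at \<theta>)"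
      and dQ: "((\<lambda>\<theta>. 1 / Q t \<theta>) has_real_derivative - (?S * (w t * ?k)) / ?Q ^ 3) (at \<theta>)"
      using has_real_derivative_arclength_factor(2,3)[OF dS\<theta>[OF t \<theta>]] by (simp_all add: Q_def)
    let ?M' = "g * ?Z * (w t * ?S) * X' t \<theta> + g / 2 * ?Z\<^sup>2 * w' t
        + \<sigma> * ((w t * ?k / ?Q ^ 3) * ?Zs + ?S / ?Q * (w' t * ?S + w t * Ss t \<theta>)
               + (- (?S * (w t * ?k)) / ?Q ^ 3 * X' t \<theta> + 1 / ?Q * w' t))"
    have dM: "(M has_real_derivative ?M') (at \<theta>)"
      unfolding M_def
      by (rule DERIV_cong[OF DERIV_add[OF
            DERIV_mult[OF DERIV_cmult[OF DERIV_power[OF dZ\<theta>[OF t \<theta>], of 2], of "g / 2"] dX'\<theta>]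
            DERIV_cmult[OF DERIV_add[OF DERIV_mult[OF dSQ dZs\<theta>[OF \<theta>]] DERIV_mult[OF dQ dX'\<theta>]], of \<sigma>]]])
         (simp add: algebra_simps)
    have "?M' = N t \<theta> - w t * q ?x"
    proof -
      \<comment> \<open>Splits \<open>w' Q\<close> into the contributions \<open>w' S\<^sup>2/Q\<close> of \<open>\<partial>\<^sub>\<theta> \<partial>\<^sub>s Z\<close> and \<open>w'/Q\<close> of \<open>\<partial>\<^sub>\<theta> X'\<close>.\<close>
      have "?Q = (1 + ?S\<^sup>2) / ?Q"
        using Q_sq[of t \<theta>] Q_nz[of t \<theta>] by (simp add: power2_eq_square field_simps)
      then have "w' t * (\<sigma> * ?Q) = w' t * (\<sigma> * ((1 + ?S\<^sup>2) / ?Q))"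
        by simp
      also have "\<dots> = \<sigma> * (?S / ?Q * (w' t * ?S) + 1 / ?Q * w' t)"
        by (simp add: field_simps power2_eq_square add_divide_distrib)
      finally show ?thesis
        unfolding N_def qx by (simp add: algebra_simps diff_divide_distrib)
    qed
    with dM show "(M has_vector_derivative N t \<theta> - w t * q ?x) (at \<theta>)"
      by (simp add: has_real_derivative_iff_has_vector_derivative)
  qed simp
  then have NM: "integral {0..1} (\<lambda>\<theta>. N t \<theta> - w t * q (X t \<theta>)) = M 1 - M 0"
    by (rule integral_unique)
  have "integral {0..1} (\<lambda>\<theta>. N t \<theta> - w t * q (X t \<theta>))
      = integral {0..1} (N t) - integral {0..1} (\<lambda>\<theta>. w t * q (X t \<theta>))"
  proof (intro Henstock_Kurzweil_Integration.integral_diff integrable_continuous_real)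
    have "continuous_on (I \<times> {0..1}) (\<lambda>(s, \<theta>). N s \<theta>)"
      unfolding split_beta N_def by (intro continuous_intros pair_cont Qc ballI Q_nz)
    then show "continuous_on {0..1} (N t)" by (rule slice)
    have "continuous_on {0..1} (\<lambda>\<theta>. q (X t \<theta>))"
    proof (rule continuous_on_compose2[OF qc])
      show "X t ` {0..1} \<subseteq> {L t..R t}"
        unfolding X_def w_def using convex_combination_mem_Icc[OF LR'[OF t]] by blast
    qed (auto simp: X_def intro!: continuous_intros)
    then show "continuous_on {0..1} (\<lambda>\<theta>. w t * q (X t \<theta>))"
      by (intro continuous_intros)
  qed
  also have "integral {0..1} (\<lambda>\<theta>. w t * q (X t \<theta>)) = integral {L t..R t} q"
    unfolding X_def w_def by (rule integral_unit_interval_pullback[OF LR[OF t] qc, symmetric])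
  finally have "integral {0..1} (N t) = integral {L t..R t} q + (M 1 - M 0)"
    using NM by simp
  also have "M 1 - M 0 = \<sigma> * (R' t / sqrt (1 + (m t (R t))\<^sup>2) - L' t / sqrt (1 + (m t (L t))\<^sup>2))"
    by (simp add: M_def Z0[OF t] Z1[OF t] Zs0[OF t] Zs1[OF t] Q_def S_def defs algebra_simps)
  finally have dE': "((\<lambda>s. integral {0..1} (\<lambda>\<theta>. w s * (g / 2 * (Z s \<theta>)\<^sup>2 + \<sigma> * Q s \<theta>)) - \<gamma> * w s)
      has_real_derivative integral {L t..R t} q
        + \<sigma> * (R' t / sqrt (1 + (m t (R t))\<^sup>2) - L' t / sqrt (1 + (m t (L t))\<^sup>2)) - \<gamma> * w' t) (at t)"
    using DERIV_diff[OF dE DERIV_cmult[OF dw[OF t]]] by simp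
  have eq: "integral {0..1} (\<lambda>\<theta>. w s * (g / 2 * (Z s \<theta>)\<^sup>2 + \<sigma> * Q s \<theta>)) - \<gamma> * w s
      = integral {L s..R s} (\<lambda>x. g / 2 * (\<zeta> s x)\<^sup>2)
        + integral {L s..R s} (\<lambda>x. \<sigma> * sqrt (1 + (m s x)\<^sup>2)) - \<gamma> * (R s - L s)" if s: "s \<in> I" for s
  proof -
    have "continuous_on {L s..R s} (\<lambda>x. (s, x))" "Pair s ` {L s..R s} \<subseteq> K"
      using s by (auto simp: K_def intro!: continuous_intros)
    from continuous_on_compose2[OF C1_uptoD(1)[OF \<zeta>] this] continuous_on_compose2[OF C1_uptoD(1)[OF m] this]
    have c: "continuous_on {L s..R s} (\<zeta> s)" "continuous_on {L s..R s} (m s)"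
      by simp_all
    have "integral {L s..R s} (\<lambda>x. g / 2 * (\<zeta> s x)\<^sup>2) + integral {L s..R s} (\<lambda>x. \<sigma> * sqrt (1 + (m s x)\<^sup>2))
        = integral {L s..R s} (\<lambda>x. g / 2 * (\<zeta> s x)\<^sup>2 + \<sigma> * sqrt (1 + (m s x)\<^sup>2))"
      by (intro Henstock_Kurzweil_Integration.integral_add[symmetric] integrable_continuous_real
            continuous_intros c)
    also have "\<dots> = integral {0..1} (\<lambda>\<theta>. w s * (g / 2 * (Z s \<theta>)\<^sup>2 + \<sigma> * Q s \<theta>))"
      unfolding Z_def Q_def S_def X_def w_def
      by (rule integral_unit_interval_pullback[OF LR[OF s]]) (intro continuous_intros c)
    finally show ?thesis by (simp add: w_def)
  qed
  show ?thesis
    by (rule has_field_derivative_transform_within_open[OF dE'[unfolded w'_def] \<open>open I\<close> t eq])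
qed

section \<open>The energy identity\<close>

lemma increasing_C2_diffeoD:
  assumes "increasing_C2_diffeo V"
  shows "continuous_on UNIV V" and "inv V (V x) = x"
  using assms
  by (auto simp: increasing_C2_diffeo_def C2_real_def bij_is_inj
        intro: C1_differentiable_imp_continuous_on)

theorem theorem1p1:
  fixes g \<sigma> \<mu> \<beta> \<gamma> :: real
    and V W :: "real \<Rightarrow> real"
    and I :: "real set"
    and u :: "real \<Rightarrow> real^2 \<Rightarrow> real^2"
    and P :: "real \<Rightarrow> real^2 \<Rightarrow> real"
    and \<zeta> :: "real \<Rightarrow> real \<Rightarrow> real"
    and L R :: "real \<Rightarrow> real"
  assumes "g > 0" and "\<sigma> > 0" and "\<mu> > 0" and "\<beta> > 0"
    and "0 < \<gamma> / \<sigma>" and "\<gamma> / \<sigma> < 1"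
    and "increasing_C2_diffeo V" and "V 0 = 0" and "W = inv V"
    and "open I"
    and "droplet_solution g \<sigma> \<mu> \<beta> \<gamma> V I u P \<zeta> L R"
    and "droplet_regular I L R \<zeta> u P"
    and "t \<in> I"
  defines "energy \<equiv> \<lambda>s.
      integral {L s..R s} (\<lambda>x. g / 2 * \<bar>\<zeta> s x\<bar>\<^sup>2)
      + integral {L s..R s} (\<lambda>x. \<sigma> * sqrt (1 + \<bar>slope (L s) (R s) (\<zeta> s) x\<bar>\<^sup>2))
      - \<gamma> * (R s - L s)"
    and "dissipation \<equiv>
      integral (fluid_domain (L t) (R t) (\<zeta> t)) (\<lambda>z. \<mu> / 2 * (norm (sym_gradient (u t) z))\<^sup>2)
      + integral {L t..R t} (\<lambda>x. \<beta> * \<bar>u t (bottom_point x) \<bullet> bottom_tangent\<bar>\<^sup>2)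
      + (W (deriv L t) * deriv L t + W (deriv R t) * deriv R t)"
  shows "energy differentiable (at t) \<and> deriv energy t + dissipation = 0"
proof -
  let ?l = "L t" and ?r = "R t" and ?h = "\<zeta> t" and ?\<Omega> = "fluid_domain (L t) (R t) (\<zeta> t)"
  let ?m = "\<lambda>s. slope (L s) (R s) (\<zeta> s)"
  let ?U = "{(s, x). s \<in> I \<and> L s < x \<and> x < R s}" and ?K = "{(s, x). s \<in> I \<and> L s \<le> x \<and> x \<le> R s}"
  note sol = \<open>droplet_solution g \<sigma> \<mu> \<beta> \<gamma> V I u P \<zeta> L R\<close>[unfolded droplet_solution_def]
  note reg = \<open>droplet_regular I L R \<zeta> u P\<close>[unfolded droplet_regular_def Let_def]
  have geom: "droplet_geometry I L R \<zeta>" and kin: "kinematic_condition I L R \<zeta> u"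
    and law: "contact_point_law \<sigma> \<gamma> V I L R \<zeta>"
    using sol by auto
  have stokes: "stokes_in_bulk \<mu> ?\<Omega> (u t) (P t)"
    and surface: "free_surface_condition g \<sigma> \<mu> ?l ?r ?h (u t) (P t)"
    and slip: "navier_slip_condition \<mu> \<beta> ?l ?r ?h (u t) (P t)"
    using sol \<open>t \<in> I\<close> by auto
  have \<zeta>: "C1_upto ?U ?K (\<lambda>(s, x). \<zeta> s x)" and m: "C1_upto ?U ?K (\<lambda>(s, x). ?m s x)"
    using reg by auto
  have u: "C1_upto ?\<Omega> (closure ?\<Omega>) (u t)" and Ju: "C1_upto ?\<Omega> ?\<Omega> (\<lambda>z. jacobian (u t) (at z))"
    and P: "C1_upto ?\<Omega> ?\<Omega> (P t)" and Pc: "continuous_on (closure ?\<Omega>) (P t)"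
    using reg \<open>t \<in> I\<close> by auto
  have LR: "L s < R s" if "s \<in> I" for s
    using geom that by (simp add: droplet_geometry_def)
  have dL: "(L has_real_derivative deriv L s) (at s)" and dR: "(R has_real_derivative deriv R s) (at s)"
    if "s \<in> I" for s
    using reg that by (auto simp: DERIV_deriv_iff_real_differentiable)
  have Lc: "continuous_on I L" and Rc: "continuous_on I R"
    by (rule DERIV_continuous_on, rule has_field_derivative_at_within, rule dL dR, assumption)+
  have mc: "continuous_on I (\<lambda>s. ?m s (c s))"
    if "continuous_on I c" and "\<And>s. s \<in> I \<Longrightarrow> c s \<in> {L s..R s}" for c
  proof -
    have "continuous_on I (\<lambda>s. (s, c s))" by (intro continuous_intros that(1))
    from continuous_on_compose2[OF C1_uptoD(1)[OF m] this] show ?thesis using that(2) by auto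
  qed
  have pos: "1 + y\<^sup>2 > 0" for y :: real by (simp add: add_pos_nonneg)
  \<comment> \<open>The contact point law makes the differentiable functions \<open>L\<close> and \<open>R\<close> continuously differentiable,
    because the contact slopes vary continuously in time.\<close>
  have L': "continuous_on I (deriv L)"
  proof (rule continuous_on_eq)
    show "V (\<sigma> / sqrt (1 + (?m s (L s))\<^sup>2) - \<gamma>) = deriv L s" if "s \<in> I" for s
      using law that by (simp add: contact_point_law_def)
    have "continuous_on I (\<lambda>s. ?m s (L s))"
      by (rule mc[OF Lc]) (use LR in force)
    then have "continuous_on I (\<lambda>s. \<sigma> / sqrt (1 + (?m s (L s))\<^sup>2) - \<gamma>)"
      using pos by (intro continuous_intros) (auto simp: less_imp_neq[symmetric])
    then show "continuous_on I (\<lambda>s. V (\<sigma> / sqrt (1 + (?m s (L s))\<^sup>2) - \<gamma>))"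
      by (rule continuous_on_compose2[OF increasing_C2_diffeoD(1)[OF \<open>increasing_C2_diffeo V\<close>]]) simp
  qed
  have R': "continuous_on I (deriv R)"
  proof (rule continuous_on_eq)
    show "V (\<gamma> - \<sigma> / sqrt (1 + (?m s (R s))\<^sup>2)) = deriv R s" if "s \<in> I" for s
      using law that by (simp add: contact_point_law_def)
    have "continuous_on I (\<lambda>s. ?m s (R s))"
      by (rule mc[OF Rc]) (use LR in force)
    then have "continuous_on I (\<lambda>s. \<gamma> - \<sigma> / sqrt (1 + (?m s (R s))\<^sup>2))"
      using pos by (intro continuous_intros) (auto simp: less_imp_neq[symmetric])
    then show "continuous_on I (\<lambda>s. V (\<gamma> - \<sigma> / sqrt (1 + (?m s (R s))\<^sup>2)))"
      by (rule continuous_on_compose2[OF increasing_C2_diffeoD(1)[OF \<open>increasing_C2_diffeo V\<close>]]) simp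
  qed
  have "continuous_on {?l..?r} (\<lambda>x. (t, x))" "Pair t ` {?l..?r} \<subseteq> ?K"
    using \<open>t \<in> I\<close> by (auto intro!: continuous_intros)
  from continuous_on_compose2[OF C1_uptoD(1)[OF \<zeta>] this] continuous_on_compose2[OF C1_uptoD(1)[OF m] this]
  have hc: "continuous_on {?l..?r} ?h" and slope_c: "continuous_on {?l..?r} (?m t)"
    by simp_all
  have dh: "(?h has_real_derivative ?m t x) (at x)" if x: "x \<in> {?l<..<?r}" for x
  proof -
    have "((\<lambda>x. (t, x)) has_vector_derivative (0, 1)) (at x)"
      by (auto intro!: derivative_eq_intros has_vector_derivative_Pair)
    from has_real_derivative_along_curve[OF this C1_uptoD(2)[OF \<zeta>, of "(t, x)"]] x \<open>t \<in> I\<close>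
    obtain d where d: "(?h has_real_derivative d) (at x)" by auto
    with slope_eq_derivative[OF d] x show ?thesis by simp
  qed
  obtain q where qc: "continuous_on {?l..?r} q"
    and q: "\<And>x. x \<in> {?l<..<?r} \<Longrightarrow> q x = (g * ?h x - \<sigma> * curvature ?l ?r ?h x)
           * (u t (surface_point ?h x) $ 2 - ?m t x * u t (surface_point ?h x) $ 1)"
    and balance: "integral {?l..?r} q + integral ?\<Omega> (\<lambda>z. \<mu> / 2 * (norm (sym_gradient (u t) z))\<^sup>2)
         + integral {?l..?r} (\<lambda>x. \<beta> * \<bar>u t (bottom_point x) \<bullet> bottom_tangent\<bar>\<^sup>2) = 0"
    using geom LR[OF \<open>t \<in> I\<close>] \<open>t \<in> I\<close>
      stokes_power_balance[OF _ hc _ _ _ dh slope_c u Ju P Pc stokes surface slip]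
    unfolding droplet_geometry_def by blast
  have q': "q x = (g * ?h x - \<sigma> * curvature ?l ?r ?h x) * deriv (\<lambda>s. \<zeta> s x) t"
    if x: "x \<in> {?l<..<?r}" for x
  proof -
    have "deriv (\<lambda>s. \<zeta> s x) t
        = u t (surface_point ?h x) $ 2 - ?m t x * u t (surface_point ?h x) $ 1"
      using kin x \<open>t \<in> I\<close> unfolding kinematic_condition_def by (force simp: algebra_simps)
    with q[OF x] show ?thesis by simp
  qed
  have dE: "(energy has_real_derivative
      integral {?l..?r} q
      + \<sigma> * (deriv R t / sqrt (1 + (?m t ?r)\<^sup>2) - deriv L t / sqrt (1 + (?m t ?l)\<^sup>2))
      - \<gamma> * (deriv R t - deriv L t)) (at t)"
    using droplet_energy_derivative[OF \<open>open I\<close> \<open>t \<in> I\<close> dL dR L' R' geom \<zeta> m qc q']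
    by (simp add: energy_def)
  \<comment> \<open>The contact point law, inverted: the remaining endpoint terms of the energy are the dissipation
    of the moving contact points.\<close>
  have WL: "W (deriv L t) = \<sigma> / sqrt (1 + (?m t ?l)\<^sup>2) - \<gamma>"
    and WR: "W (deriv R t) = \<gamma> - \<sigma> / sqrt (1 + (?m t ?r)\<^sup>2)"
    using law \<open>t \<in> I\<close> increasing_C2_diffeoD(2)[OF \<open>increasing_C2_diffeo V\<close>]
    by (simp_all add: contact_point_law_def \<open>W = inv V\<close>)
  have "deriv energy t + dissipation = 0"
    unfolding DERIV_imp_deriv[OF dE] dissipation_def WL WR using balance by (simp add: algebra_simps)
  with dE show ?thesis
    by (auto simp: real_differentiable_def)
qed

end
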